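(* Let $T,\lambda\in(0,\infty)$. Suppose $\boldsymbol{x}\in\boldsymbol{\ell}_1^\downarrow$ and $\alpha,\theta:[0,T]\times[0,1]\to\mathbb{R}_+$ are measurable and satisfy $$\int_{\mathbb{X}_T}\ell(\alpha(s,y))\,ds\,dy<\infty,\qquad\|\theta\|_\infty:=\sup_{(s,y)\in[0,T]\times[0,1]}\theta(s,y)<\infty,$$ and that, for each $s\in[0,T]$, $\theta(s,\cdot)$ is continuous at a.e. $y\in[0,1]$. Then there exists a unique pair $(\boldsymbol{\zeta},\boldsymbol{\psi})\in\mathcal{C}$ such that for all $t\in[0,T]$ $$\psi_1(t)=x_1+\lambda\int_{\mathbb{X}_t}\alpha(s,y)\,ds\,dy-\int_{\mathbb{X}_t}\mathbf{1}_{[1-\zeta_1(s),1-\zeta_2(s))}(y)\,\theta(s,y)\,ds\,dy,$$ $$\psi_i(t)=x_i-\int_{\mathbb{X}_t}\mathbf{1}_{[1-\zeta_i(s),1-\zeta_{i+1}(s))}(y)\,\theta(s,y)\,ds\,dy,\quad i\ge2.$$ In particular, $\boldsymbol{\varphi}\in\mathcal{S}(\boldsymbol{\zeta},\boldsymbol{\psi})$, where $\varphi_0=\alpha$ and $$\varphi_i(s,y)=\theta(s,y+1-\zeta_i(s))\,\mathbf{1}_{[0,\zeta_i(s)-\zeta_{i+1}(s))}(y)+\mathbf{1}_{[\zeta_i(s)-\zeta_{i+1}(s),1)}(y),\quad i\ge1.$$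
   Context: $\mathbb{X}_t=[0,t]\times[0,1]$; $\ell(z)=z\log z-z+1$ for $z\ge0$. $\boldsymbol{\ell}_1$ is the space of real sequences $\boldsymbol{x}=(x_1,x_2,\dots)$ with $\|\boldsymbol{x}\|_1=\sum_i|x_i|<\infty$; $\boldsymbol{\ell}_1^\downarrow=\{\boldsymbol{x}\in\boldsymbol{\ell}_1:x_i\ge x_{i+1},\ x_i\in[0,1]\ \forall i\}$ with norm $\|\cdot\|_1$. $\mathbb{R}^\infty$ has the product topology. $\mathcal{C}$ is the set of $(\boldsymbol{\zeta},\boldsymbol{\psi})\in\mathbb{C}([0,T]:\boldsymbol{\ell}_1^\downarrow\times\boldsymbol{\ell}_1)$ such that (i) $\boldsymbol{\zeta}(0)=\boldsymbol{\psi}(0)=\boldsymbol{x}$ and each $\zeta_i,\psi_i$ is absolutely continuous on $[0,T]$; (ii) there is $\boldsymbol{\eta}=(\eta_i)_{i\ge1}\in\mathbb{C}([0,T]:\mathbb{R}^\infty)$ such that, with $\eta_0\equiv0$, $\zeta_i(t)=\psi_i(t)+\eta_{i-1}(t)-\eta_i(t)$ for all $t\in[0,T]$, $i\in\mathbb{N}$, and for each $i\ge1$: $\eta_i(0)=0$, $\eta_i$ is nondecreasing, and $\int_0^T(1-\zeta_i(s))\,\eta_i(ds)=0$. For $(\boldsymbol{\zeta},\boldsymbol{\psi})\in\mathcal{C}$, $\mathcal{S}(\boldsymbol{\zeta},\boldsymbol{\psi})$ is the set of $\boldsymbol{\varphi}=(\varphi_i)_{i\in\mathbb{N}_0}$ of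 measurable functions $\varphi_i:[0,T]\times[0,1]\to\mathbb{R}_+$ (values on Lebesgue-null sets being irrelevant) such that for all $t\in[0,T]$: $\psi_1(t)=x_1+\lambda\int_{\mathbb{X}_t}\varphi_0\,ds\,dy-\int_{\mathbb{X}_t}\mathbf{1}_{[0,\zeta_1(s)-\zeta_2(s))}(y)\varphi_1(s,y)\,ds\,dy$ and $\psi_i(t)=x_i-\int_{\mathbb{X}_t}\mathbf{1}_{[0,\zeta_i(s)-\zeta_{i+1}(s))}(y)\varphi_i(s,y)\,ds\,dy$ for $i\ge2$. *)

theory Defs
  imports "HOL-Analysis.Analysis"
begin

(* Sequences (x_1, x_2, ...) are functions nat => real read at the indices i >= 1; the entry at
   index 0 is ignored, except for the families eta and phi, which are indexed from 0.
   A path of sequences is a function f with f t i the i-th coordinate at time t; only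
   t in [0,T] matters. *)

definition strip :: "real \<Rightarrow> (real \<times> real) set" where
  "strip t = {0..t} \<times> {0..1}"

(* ln 0 = 0 in HOL, hence ell 0 = 1, the usual convention 0 log 0 = 0. *)
definition ell :: "real \<Rightarrow> real" where
  "ell z = z * ln z - z + 1"

definition ell1 :: "(nat \<Rightarrow> real) set" where
  "ell1 = {x. summable (\<lambda>i. \<bar>x (Suc i)\<bar>)}"

definition norm1 :: "(nat \<Rightarrow> real) \<Rightarrow> real" where
  "norm1 x = (\<Sum>i. \<bar>x (Suc i)\<bar>)"

definition ell1_down :: "(nat \<Rightarrow> real) set" where
  "ell1_down = {x \<in> ell1. \<forall>i\<ge>1. x i \<ge> x (i + 1) \<and> x i \<in> {0..1}}"

definition continuous_ell1 :: "real set \<Rightarrow> (real \<Rightarrow> nat \<Rightarrow> real) \<Rightarrow> bool" where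
  "continuous_ell1 I f \<longleftrightarrow>
     (\<forall>t\<in>I. f t \<in> ell1 \<and> ((\<lambda>s. norm1 (\<lambda>i. f s i - f t i)) \<longlongrightarrow> 0) (at t within I))"

definition abs_continuous_on :: "real \<Rightarrow> real \<Rightarrow> (real \<Rightarrow> real) \<Rightarrow> bool" where
  "abs_continuous_on a b f \<longleftrightarrow>
     (\<forall>\<epsilon>>0. \<exists>\<delta>>0. \<forall>D :: (real \<times> real) set.
        finite D \<and> (\<forall>(u, v)\<in>D. a \<le> u \<and> u \<le> v \<and> v \<le> b) \<and>
        pairwise (\<lambda>p q. {fst p<..<snd p} \<inter> {fst q<..<snd q} = {}) D \<and>
        (\<Sum>(u, v)\<in>D. v - u) < \<delta>
        \<longrightarrow> (\<Sum>(u, v)\<in>D. \<bar>f v - f u\<bar>) < \<epsilon>)"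

(* Stieltjes measure of a continuous nondecreasing g on [0,T]. interval_measure expects a
   function on the whole line, so g is extended by constants, which carries no mass
   outside [0,T]. *)
definition stieltjes :: "real \<Rightarrow> (real \<Rightarrow> real) \<Rightarrow> real measure" where
  "stieltjes T g = interval_measure (\<lambda>s. g (max 0 (min T s)))"

(* continuous_on for functions into nat => real refers to the product topology. *)
definition paths_C ::
  "real \<Rightarrow> (nat \<Rightarrow> real) \<Rightarrow> ((real \<Rightarrow> nat \<Rightarrow> real) \<times> (real \<Rightarrow> nat \<Rightarrow> real)) set" where
  "paths_C T x = {(\<zeta>, \<psi>).
     continuous_ell1 {0..T} \<zeta> \<and> (\<forall>t\<in>{0..T}. \<zeta> t \<in> ell1_down) \<and>
     continuous_ell1 {0..T} \<psi> \<and>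
     (\<forall>i\<ge>1. \<zeta> 0 i = x i \<and> \<psi> 0 i = x i \<and>
        abs_continuous_on 0 T (\<lambda>t. \<zeta> t i) \<and> abs_continuous_on 0 T (\<lambda>t. \<psi> t i)) \<and>
     (\<exists>\<eta> :: real \<Rightarrow> nat \<Rightarrow> real.
        continuous_on {0..T} \<eta> \<and>
        (\<forall>t\<in>{0..T}. \<eta> t 0 = 0) \<and>
        (\<forall>t\<in>{0..T}. \<forall>i\<ge>1. \<zeta> t i = \<psi> t i + \<eta> t (i - 1) - \<eta> t i) \<and>
        (\<forall>i\<ge>1. \<eta> 0 i = 0 \<and> mono_on {0..T} (\<lambda>t. \<eta> t i) \<and>
           (LINT s:{0..T}|stieltjes T (\<lambda>t. \<eta> t i). 1 - \<zeta> s i) = 0))}"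

(* Functions [0,T] x [0,1] -> R_+; their values elsewhere are irrelevant. *)
definition nonneg_measurable :: "real \<Rightarrow> (real \<times> real \<Rightarrow> real) set" where
  "nonneg_measurable T =
     {f. f \<in> borel_measurable (restrict_space borel (strip T)) \<and> (\<forall>p\<in>strip T. 0 \<le> f p)}"

(* The integrands are nonnegative and the equations force the integrals to be finite.
   Since the Bochner integral of a non-integrable function is 0, this finiteness has to be
   stated explicitly. *)
definition controls_S ::
  "real \<Rightarrow> real \<Rightarrow> (nat \<Rightarrow> real) \<Rightarrow> (real \<Rightarrow> nat \<Rightarrow> real) \<Rightarrow> (real \<Rightarrow> nat \<Rightarrow> real)
   \<Rightarrow> (nat \<Rightarrow> real \<times> real \<Rightarrow> real) set" where
  "controls_S T lam x \<zeta> \<psi> = {\<phi>.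
     (\<forall>i. \<phi> i \<in> nonneg_measurable T) \<and>
     set_integrable lborel (strip T) (\<phi> 0) \<and>
     (\<forall>i\<ge>1. set_integrable lborel (strip T)
        (\<lambda>(s, y). indicator {0..<\<zeta> s i - \<zeta> s (i + 1)} y * \<phi> i (s, y))) \<and>
     (\<forall>t\<in>{0..T}.
        \<psi> t 1 = x 1 + lam * (LINT p:strip t|lborel. \<phi> 0 p)
          - (LINT (s, y):strip t|lborel. indicator {0..<\<zeta> s 1 - \<zeta> s 2} y * \<phi> 1 (s, y)) \<and>
        (\<forall>i\<ge>2. \<psi> t i = x i
          - (LINT (s, y):strip t|lborel. indicator {0..<\<zeta> s i - \<zeta> s (i + 1)} y * \<phi> i (s, y))))}"

definition solves ::
  "real \<Rightarrow> real \<Rightarrow> (nat \<Rightarrow> real) \<Rightarrow> (real \<times> real \<Rightarrow> real) \<Rightarrow> (real \<times> real \<Rightarrow> real)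
   \<Rightarrow> (real \<Rightarrow> nat \<Rightarrow> real) \<Rightarrow> (real \<Rightarrow> nat \<Rightarrow> real) \<Rightarrow> bool" where
  "solves T lam x \<alpha> \<theta> \<zeta> \<psi> \<longleftrightarrow>
     (\<forall>t\<in>{0..T}.
        \<psi> t 1 = x 1 + lam * (LINT p:strip t|lborel. \<alpha> p)
          - (LINT (s, y):strip t|lborel. indicator {1 - \<zeta> s 1..<1 - \<zeta> s 2} y * \<theta> (s, y)) \<and>
        (\<forall>i\<ge>2. \<psi> t i = x i
          - (LINT (s, y):strip t|lborel. indicator {1 - \<zeta> s i..<1 - \<zeta> s (i + 1)} y * \<theta> (s, y))))"

(* Products with a vanishing indicator are 0, so theta is in effect evaluated only in
   [0,T] x [0,1]. *)
definition shifted_control ::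
  "(real \<times> real \<Rightarrow> real) \<Rightarrow> (real \<times> real \<Rightarrow> real) \<Rightarrow> (real \<Rightarrow> nat \<Rightarrow> real)
   \<Rightarrow> nat \<Rightarrow> real \<times> real \<Rightarrow> real" where
  "shifted_control \<alpha> \<theta> \<zeta> i = (if i = 0 then \<alpha> else (\<lambda>(s, y).
     \<theta> (s, y + 1 - \<zeta> s i) * indicator {0..<\<zeta> s i - \<zeta> s (i + 1)} y
       + indicator {\<zeta> s i - \<zeta> s (i + 1)..<1} y))"

end

theory Submission
  imports Defs
begin

text \<open>Since \<zeta>_i is nonincreasing in i, the constraint \<zeta>_i = 1 is equivalent to
  P_i = i for the partial sum P_i = \<zeta>_1 + ... + \<zeta>_i, and all reflection terms except \<eta>_i cancel in P_i.
  Thus every P_i solves its own one-dimensional Skorokhod problem with upper barrier i, driven by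
  a path that depends on \<zeta>_1 and \<zeta>_(i+1) only, and in a Lipschitz way: the service rate
  \<integral> \<theta>(s,y) over y \<ge> 1 - z is Lipschitz in z because \<theta> is bounded. Estimates uniform in i give
  uniqueness and, by Picard iteration, a fixed point. For the fixed point, w_i = (\<zeta>_(i+1) - \<zeta>_i)^+ satisfies
  w_i \<le> L \<integral> w_(i+1), because \<eta>_i is flat where w_i > 0; iterating gives w = 0. For large i the
  barrier i is out of reach, so \<eta>_i = 0, the P_i are bounded in i, which forces \<zeta>_i \<ge> 0, and the tail sums of
  \<zeta>(t) are at most those of x, which gives continuity in \<ell>_1.\<close>

section \<open>The one-dimensional Skorokhod problem\<close>

text \<open>Taken level by level, each regulator would drive the next level and Lipschitz constants
  would grow with i; a partial sum sees only two drift terms, whatever i is. The price is that the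
  constraint on a level and the constraint on a partial sum agree only if the levels are ordered and
  at most 1, which is not known of the iterates. The iteration therefore runs over arbitrary
  continuous families, with a drift that makes sense for every continuous path, and order, sign and
  bounds are proved for the fixed point only. Complementarity is expressed by flatness of the
  regulator on intervals where the path is below the barrier; Stieltjes integrals enter only in the
  translation to and from the statement. A bound C * s ^ n on the levels becomes 8 * L * C / (n + 1)
  * s ^ (n + 1) after one application of the map, so factorials appear on all of [0, T] at once and
  time need not be cut into short pieces. The same mechanism, with other constants, settles
  uniqueness, convergence and the order of the levels.\<close>

lemma last_time_above:
  fixes f :: "real \<Rightarrow> real"
  assumes f: "continuous_on {0..t} f" and s: "s \<in> {0..t}" "c \<le> f s"
  obtains r where "r \<in> {0..t}" "c \<le> f r" "\<And>s. r < s \<Longrightarrow> s \<le> t \<Longrightarrow> f s < c"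
proof -
  define S where "S = {s \<in> {0..t}. c \<le> f s}"
  have "closed S"
    unfolding S_def by (intro continuous_on_closed_Collect_le f continuous_intros)
  moreover have "bounded S"
    by (rule bounded_subset[of "{0..t}"]) (auto simp: S_def)
  ultimately have "compact S"
    by (simp add: compact_eq_bounded_closed)
  moreover have "S \<noteq> {}"
    using s by (auto simp: S_def)
  ultimately obtain r where r: "r \<in> S" "\<forall>s\<in>S. s \<le> r"
    using compact_attains_sup[of S] by auto
  show thesis
  proof (rule that[of r])
    show "f s < c" if "r < s" "s \<le> t" for s
    proof (rule ccontr)
      assume "\<not> f s < c"
      then have "s \<in> S" using that r(1) by (auto simp: S_def)
      then show False using r(2) that by force
    qed
  qed (use r in \<open>auto simp: S_def\<close>)
qed

text \<open>The Skorokhod problem for the path \<open>Q\<close> with upper barrier \<open>c\<close>;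
  the reflected path is \<open>Q - \<eta>\<close>. Complementarity is encoded as flatness on closed
  intervals strictly below the barrier, the form in which the comparison argument uses it.\<close>

definition regulates :: "real \<Rightarrow> real \<Rightarrow> (real \<Rightarrow> real) \<Rightarrow> (real \<Rightarrow> real) \<Rightarrow> bool" where
  "regulates T c Q \<eta> \<longleftrightarrow> \<eta> 0 = 0 \<and> mono_on {0..T} \<eta> \<and> continuous_on {0..T} \<eta> \<and>
     (\<forall>t\<in>{0..T}. Q t - \<eta> t \<le> c) \<and>
     (\<forall>a b. 0 \<le> a \<longrightarrow> a \<le> b \<longrightarrow> b \<le> T \<longrightarrow> (\<forall>s\<in>{a..b}. Q s - \<eta> s < c) \<longrightarrow> \<eta> a = \<eta> b)"

lemma regulatesD:
  assumes "regulates T c Q \<eta>"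
  shows "\<eta> 0 = 0" "continuous_on {0..T} \<eta>"
    and "\<And>u v. 0 \<le> u \<Longrightarrow> u \<le> v \<Longrightarrow> v \<le> T \<Longrightarrow> \<eta> u \<le> \<eta> v"
    and "\<And>t. 0 \<le> t \<Longrightarrow> t \<le> T \<Longrightarrow> Q t - \<eta> t \<le> c"
    and "\<And>a b. 0 \<le> a \<Longrightarrow> a \<le> b \<Longrightarrow> b \<le> T \<Longrightarrow> (\<And>s. a \<le> s \<Longrightarrow> s \<le> b \<Longrightarrow> Q s - \<eta> s < c) \<Longrightarrow> \<eta> a = \<eta> b"
  using assms by (simp_all add: regulates_def mono_on_def)

text \<open>The definition asks for the left end to be strictly below the barrier too. Here r may
  lie on it, as a last contact time does: the regulator is constant on (r, t], and continuity
  carries its value back to r.\<close>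

lemma regulates_flat:
  assumes reg: "regulates T c Q \<eta>"
    and r: "0 \<le> r" "r \<le> t" "t \<le> T" and below: "\<And>s. r < s \<Longrightarrow> s \<le> t \<Longrightarrow> Q s - \<eta> s < c"
  shows "\<eta> r = \<eta> t"
proof (cases "r = t")
  case False
  have flat: "\<eta> s = \<eta> t" if "r < s" "s \<le> t" for s
    by (rule regulatesD(5)[OF reg]) (use that r below in auto)
  have cont: "continuous_on {0..T} \<eta>" using regulatesD(2)[OF reg] .
  have "(\<eta> \<longlongrightarrow> \<eta> r) (at r within {r..t})"
    using cont r by (metis atLeastAtMost_iff atLeastatMost_subset_iff continuous_on_def
        continuous_on_subset order_refl)
  then have "(\<eta> \<longlongrightarrow> \<eta> r) (at_right r)"
    using r False by (metis at_within_Icc_at_right order_le_less)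
  moreover have "(\<eta> \<longlongrightarrow> \<eta> t) (at_right r)"
  proof (rule tendsto_eventually)
    show "\<forall>\<^sub>F s in at_right r. \<eta> s = \<eta> t"
      using eventually_at_right_real[of r t] r False
      by (auto elim!: eventually_mono intro: flat)
  qed
  ultimately show ?thesis
    using tendsto_unique trivial_limit_at_right_real by blast
qed simp

text \<open>Let r be the last contact time of \<open>Q - \<eta>\<close> before t. Since r the
  regulator has not grown, and at r it is at most \<open>Q r - c\<close>, which the barrier
  constraint and the monotonicity of \<open>\<eta>'\<close> bound by \<open>\<eta>' t + d\<close>.
  Without contact, \<open>\<eta>\<close> is still 0.\<close>

lemma regulates_le:
  assumes reg: "regulates T c Q \<eta>" "regulates T c Q' \<eta>'" and Q: "continuous_on {0..T} Q"
    and t: "t \<in> {0..T}" and d: "0 \<le> d" "\<And>s. s \<in> {0..t} \<Longrightarrow> Q s \<le> Q' s + d"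
  shows "\<eta> t \<le> \<eta>' t + d"
proof (cases "\<exists>s\<in>{0..t}. c \<le> Q s - \<eta> s")
  case True
  then obtain s where s: "s \<in> {0..t}" "c \<le> Q s - \<eta> s" by blast
  have "continuous_on {0..t} (\<lambda>s. Q s - \<eta> s)"
    using regulatesD(2)[OF reg(1)] Q t
    by (intro continuous_intros) (auto elim!: continuous_on_subset)
  from last_time_above[OF this s] obtain r where r: "r \<in> {0..t}" "c \<le> Q r - \<eta> r"
    "\<And>s. r < s \<Longrightarrow> s \<le> t \<Longrightarrow> Q s - \<eta> s < c" by metis
  have "\<eta> t = \<eta> r"
    using regulates_flat[OF reg(1), of r t] r t by auto
  also have "\<dots> \<le> Q r - c" using r by simp
  also have "\<dots> \<le> Q' r - c + d" using d(2)[of r] r by simp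
  also have "\<dots> \<le> \<eta>' r + d"
    using regulatesD(4)[OF reg(2), of r] r t by simp
  also have "\<eta>' r \<le> \<eta>' t"
    using regulatesD(3)[OF reg(2), of r t] r t by simp
  finally show ?thesis by simp
next
  case False
  then have "\<eta> t = 0"
    using regulates_flat[OF reg(1), of 0 t] regulatesD(1)[OF reg(1)] t by (force simp: not_le)
  moreover have "0 \<le> \<eta>' t"
    using regulatesD(1)[OF reg(2)] regulatesD(3)[OF reg(2), of 0 t] t by simp
  ultimately show ?thesis using d by simp
qed

text \<open>The explicit solution of the one-sided Skorokhod problem: the largest overshoot so far
  is the least amount that must have been removed.\<close>

definition running_excess :: "real \<Rightarrow> (real \<Rightarrow> real) \<Rightarrow> real \<Rightarrow> real" where
  "running_excess c Q t = (SUP s\<in>{0..t}. max 0 (Q s - c))"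

lemma dominated_increments_continuous:
  fixes f V :: "real \<Rightarrow> real"
  assumes V: "continuous_on {0..T} V"
    and f: "\<And>u v. 0 \<le> u \<Longrightarrow> u \<le> v \<Longrightarrow> v \<le> T \<Longrightarrow> \<bar>f v - f u\<bar> \<le> C * (V v - V u)"
  shows "continuous_on {0..T} f"
proof -
  have "(f \<longlongrightarrow> f t) (at t within {0..T})" if t: "t \<in> {0..T}" for t
  proof -
    have "((\<lambda>s. \<bar>C\<bar> * \<bar>V s - V t\<bar>) \<longlongrightarrow> \<bar>C\<bar> * \<bar>V t - V t\<bar>) (at t within {0..T})"
      using V t by (intro tendsto_intros) (auto simp: continuous_on_def)
    then have lim: "((\<lambda>s. \<bar>C\<bar> * \<bar>V s - V t\<bar>) \<longlongrightarrow> 0) (at t within {0..T})" by simp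
    have "\<bar>f s - f t\<bar> \<le> \<bar>C\<bar> * \<bar>V s - V t\<bar>" if s: "s \<in> {0..T}" for s
    proof (cases "s \<le> t")
      case True
      then have "\<bar>f s - f t\<bar> \<le> C * (V t - V s)" using f[of s t] s t by auto
      also have "\<dots> \<le> \<bar>C\<bar> * \<bar>V s - V t\<bar>"
        by (metis abs_ge_self abs_minus_commute abs_mult)
      finally show ?thesis .
    next
      case False
      then have "\<bar>f s - f t\<bar> \<le> C * (V s - V t)" using f[of t s] s t by auto
      also have "\<dots> \<le> \<bar>C\<bar> * \<bar>V s - V t\<bar>"
        by (metis abs_ge_self abs_mult)
      finally show ?thesis .
    qed
    then have "((\<lambda>s. f s - f t) \<longlongrightarrow> 0) (at t within {0..T})"
      by (intro tendsto_0_le[OF lim, of _ 1]) (auto simp: eventually_at_filter)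
    then show ?thesis using LIM_zero_cancel by blast
  qed
  then show ?thesis by (simp add: continuous_on_def)
qed

text \<open>A running maximum cannot grow faster than its path, so the regulator inherits the
  modulus \<open>V\<close>. As \<open>V\<close> will be the same for all levels, so will the
  estimates built on it.\<close>

lemma running_excess_regulates:
  assumes Q: "\<And>u v. 0 \<le> u \<Longrightarrow> u \<le> v \<Longrightarrow> v \<le> T \<Longrightarrow> \<bar>Q v - Q u\<bar> \<le> V v - V u"
    and V: "continuous_on {0..T} V" and Q0: "Q 0 \<le> c"
  shows "regulates T c Q (running_excess c Q)"
    and "\<And>u v. 0 \<le> u \<Longrightarrow> u \<le> v \<Longrightarrow> v \<le> T \<Longrightarrow>
      0 \<le> running_excess c Q v - running_excess c Q u \<and>
      running_excess c Q v - running_excess c Q u \<le> V v - V u"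
proof -
  define \<eta> where "\<eta> = running_excess c Q"
  define f where "f s = max 0 (Q s - c)" for s
  have contQ: "continuous_on {0..T} Q"
    using dominated_increments_continuous[OF V, of Q 1] Q by simp
  then have contf: "continuous_on {0..T} f"
    unfolding f_def by (intro continuous_intros)
  have att: "\<exists>s\<in>{0..t}. \<eta> t = f s \<and> (\<forall>r\<in>{0..t}. f r \<le> f s)" if t: "t \<in> {0..T}" for t
  proof -
    have "continuous_on {0..t} f" using contf t by (auto elim!: continuous_on_subset)
    then obtain s where s: "s \<in> {0..t}" "\<And>r. r \<in> {0..t} \<Longrightarrow> f r \<le> f s"
      using continuous_attains_sup[of "{0..t}" f] t by auto
    have "\<eta> t = f s"
      unfolding \<eta>_def running_excess_def f_def[symmetric]
      by (rule cSup_eq_maximum) (use s in auto)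
    then show ?thesis using s by blast
  qed
  have ub: "f s \<le> \<eta> t" if "0 \<le> s" "s \<le> t" "t \<le> T" for s t
    using att[of t] that by force
  have least: "\<eta> t \<le> b" if "t \<in> {0..T}" "\<And>s. s \<in> {0..t} \<Longrightarrow> f s \<le> b" for t b
    using att[OF that(1)] that(2) by force
  have mono: "\<eta> u \<le> \<eta> v" if "0 \<le> u" "u \<le> v" "v \<le> T" for u v
    by (rule least) (use that ub[of _ v] in auto)
  have incr: "\<eta> v - \<eta> u \<le> V v - V u" if uv: "0 \<le> u" "u \<le> v" "v \<le> T" for u v
  proof -
    have "\<eta> v \<le> \<eta> u + (V v - V u)"
    proof (rule least)
      fix s assume s: "s \<in> {0..v}"
      have nn: "0 \<le> V v - V u" using Q[of u v] uv by linarith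
      show "f s \<le> \<eta> u + (V v - V u)"
      proof (cases "s \<le> u")
        case True then show ?thesis using ub[of s u] nn s uv by auto
      next
        case False
        then have "f s \<le> f u + (V s - V u)"
          using Q[of u s] s uv unfolding f_def by auto
        moreover have "V s \<le> V v" using Q[of s v] s uv by auto
        moreover have "f u \<le> \<eta> u" using ub[of u u] uv by auto
        ultimately show ?thesis by linarith
      qed
    qed (use uv in auto)
    then show ?thesis by simp
  qed
  have abs_incr: "\<bar>\<eta> v - \<eta> u\<bar> \<le> 1 * (V v - V u)" if "0 \<le> u" "u \<le> v" "v \<le> T" for u v
    using incr[OF that] mono[OF that] by simp
  have flat: "\<eta> a = \<eta> b" if ab: "0 \<le> a" "a \<le> b" "b \<le> T" and below: "\<forall>s\<in>{a..b}. Q s - \<eta> s < c" for a b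
  proof (rule ccontr)
    assume "\<eta> a \<noteq> \<eta> b"
    then have less: "\<eta> a < \<eta> b" using mono[OF ab] by simp
    \<comment> \<open>A rise of the running maximum between a and b is attained at some s after a,
      and there the reflected path sits on the barrier.\<close>
    obtain s where s: "s \<in> {0..b}" "\<eta> b = f s" using att[of b] ab by auto
    have "a < s" using ub[of s a] s less ab by force
    have "0 \<le> \<eta> a" using ub[of a a] ab by (simp add: f_def)
    then have "f s = Q s - c" using less s by (auto simp: f_def)
    moreover have "\<eta> s = f s" using ub[of s s] mono[of s b] s ab by force
    moreover have "Q s - \<eta> s < c" using below s \<open>a < s\<close> by simp
    ultimately show False by simp
  qed
  have "T \<ge> 0 \<Longrightarrow> \<eta> 0 = 0" using att[of 0] Q0 by (auto simp: f_def)
  moreover have "\<eta> 0 = f 0" unfolding \<eta>_def running_excess_def f_def by simp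
  ultimately have z: "\<eta> 0 = 0" using Q0 by (simp add: f_def)
  have "Q t - \<eta> t \<le> c" if "t \<in> {0..T}" for t
    using ub[of t t] that by (auto simp: f_def)
  then have "regulates T c Q \<eta>"
    unfolding regulates_def using z mono flat dominated_increments_continuous[OF V abs_incr]
    by (auto simp: mono_on_def)
  then show "regulates T c Q (running_excess c Q)" by (simp add: \<eta>_def)
  show "0 \<le> running_excess c Q v - running_excess c Q u \<and>
      running_excess c Q v - running_excess c Q u \<le> V v - V u"
    if "0 \<le> u" "u \<le> v" "v \<le> T" for u v
    using incr[OF that] mono[OF that] by (simp add: \<eta>_def)
qed


text \<open>The factor 2 collects one \<open>d\<close> from the paths and one from the
  regulators.\<close>

lemma regulated_diff_le:
  assumes reg: "regulates T c Q \<eta>" "regulates T c Q' \<eta>'"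
    and Q: "continuous_on {0..T} Q" "continuous_on {0..T} Q'"
    and t: "t \<in> {0..T}" and d: "\<And>s. s \<in> {0..t} \<Longrightarrow> \<bar>Q s - Q' s\<bar> \<le> d"
  shows "\<bar>(Q t - \<eta> t) - (Q' t - \<eta>' t)\<bar> \<le> 2 * d"
proof -
  have "0 \<le> d" using d[of t] t by force
  moreover have "Q s \<le> Q' s + d" "Q' s \<le> Q s + d" if "s \<in> {0..t}" for s
    using d[OF that] by auto
  ultimately have "\<eta> t \<le> \<eta>' t + d" "\<eta>' t \<le> \<eta> t + d"
    using regulates_le[OF reg Q(1) t] regulates_le[OF reg(2,1) Q(2) t] by auto
  then show ?thesis using d[of t] t by auto
qed

lemma exp_term_tendsto_0:
  fixes C r :: real
  shows "(\<lambda>n. C * r ^ n / fact n) \<longlonglongrightarrow> 0"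
proof -
  have "(\<lambda>n. C * (inverse (fact n) * r ^ n)) \<longlonglongrightarrow> C * 0"
    by (intro tendsto_intros summable_LIMSEQ_zero summable_exp)
  then show ?thesis by (simp add: field_simps)
qed

section \<open>The reflected system for an abstract drift\<close>

text \<open>\<open>J z t\<close> stands for the service delivered up to time t when z governs its
  range. \<open>J_compare\<close> is one-sided, so that it serves both the Lipschitz estimate and
  the order of the levels; it speaks of increments, because an order is available only after a last
  contact time; and it carries a power of s, because integration turns it into the next power
  divided by \<open>Suc n\<close>.\<close>

locale drift =
  fixes T L :: real and J :: "(real \<Rightarrow> real) \<Rightarrow> real \<Rightarrow> real"
    and A :: "real \<Rightarrow> real" and x :: "nat \<Rightarrow> real" and M :: real
  assumes T_nonneg: "0 \<le> T" and L_nonneg: "0 \<le> L"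
    and J_zero: "J z 0 = 0"
    and J_increment: "continuous_on {0..T} z \<Longrightarrow> 0 \<le> u \<Longrightarrow> u \<le> v \<Longrightarrow> v \<le> T \<Longrightarrow>
      0 \<le> J z v - J z u \<and> J z v - J z u \<le> L * (v - u)"
    and J_compare: "continuous_on {0..T} z \<Longrightarrow> continuous_on {0..T} z' \<Longrightarrow> 0 \<le> C \<Longrightarrow>
      0 \<le> u \<Longrightarrow> u \<le> v \<Longrightarrow> v \<le> T \<Longrightarrow> (\<And>s. u < s \<Longrightarrow> s \<le> v \<Longrightarrow> z s \<le> z' s + C * s ^ n) \<Longrightarrow>
      J z v - J z u \<le> J z' v - J z' u + L * C / Suc n * (v ^ Suc n - u ^ Suc n)"
    and A_zero: "A 0 = 0" and A_mono: "0 \<le> u \<Longrightarrow> u \<le> v \<Longrightarrow> v \<le> T \<Longrightarrow> A u \<le> A v"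
    and A_cont: "continuous_on {0..T} A"
    and x_nonneg: "0 \<le> x (Suc i)" and x_le_1: "x (Suc i) \<le> 1"
    and x_antimono: "x (Suc (Suc i)) \<le> x (Suc i)"
    and x_sum_le: "(\<Sum>j=1..i. x j) \<le> M"
begin

text \<open>A common modulus of continuity for all the paths below.\<close>

definition V :: "real \<Rightarrow> real" where
  "V t = A t + L * t"

text \<open>The arrival process A is treated as the zeroth regulator, so that the first level obeys the same
  equation as the others; the regulator of index 0 in the statement is 0 instead.\<close>

definition unreflected :: "(nat \<Rightarrow> real \<Rightarrow> real) \<Rightarrow> nat \<Rightarrow> real \<Rightarrow> real" where
  "unreflected \<zeta> i t = (\<Sum>j=1..i. x j) + A t - J (\<zeta> 1) t + J (\<zeta> (Suc i)) t"

definition regulators :: "(nat \<Rightarrow> real \<Rightarrow> real) \<Rightarrow> (nat \<Rightarrow> real \<Rightarrow> real) \<Rightarrow> bool" where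
  "regulators \<zeta> \<eta> \<longleftrightarrow> (\<forall>t\<in>{0..T}. \<eta> 0 t = A t) \<and>
     (\<forall>i\<ge>1. regulates T (real i) (unreflected \<zeta> i) (\<eta> i))"

definition level :: "(nat \<Rightarrow> real \<Rightarrow> real) \<Rightarrow> (nat \<Rightarrow> real \<Rightarrow> real) \<Rightarrow> nat \<Rightarrow> real \<Rightarrow> real" where
  "level \<zeta> \<eta> i t = x i - J (\<zeta> i) t + J (\<zeta> (Suc i)) t + \<eta> (i - 1) t - \<eta> i t"

definition continuous_levels :: "(nat \<Rightarrow> real \<Rightarrow> real) \<Rightarrow> bool" where
  "continuous_levels \<zeta> \<longleftrightarrow> (\<forall>i\<ge>1. continuous_on {0..T} (\<zeta> i))"

definition reflected :: "(nat \<Rightarrow> real \<Rightarrow> real) \<Rightarrow> (nat \<Rightarrow> real \<Rightarrow> real) \<Rightarrow> bool" where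
  "reflected \<zeta> \<eta> \<longleftrightarrow> continuous_levels \<zeta> \<and> regulators \<zeta> \<eta> \<and>
     (\<forall>i\<ge>1. \<forall>t\<in>{0..T}. \<zeta> i t = level \<zeta> \<eta> i t)"

text \<open>Each level is a difference of two reflected partial sums. At i = 1 the second one
  belongs to the empty sum, and it is 0 as soon as the zeroth regulator is the arrival
  process.\<close>

lemma level_eq: "i \<ge> 1 \<Longrightarrow> level \<zeta> \<eta> i t =
    (unreflected \<zeta> i t - \<eta> i t) - (unreflected \<zeta> (i - 1) t - \<eta> (i - 1) t)"
  by (cases i) (simp_all add: level_def unreflected_def)

lemma unreflected_increment:
  assumes \<zeta>: "continuous_levels \<zeta>" and uv: "0 \<le> u" "u \<le> v" "v \<le> T"
  shows "\<bar>unreflected \<zeta> i v - unreflected \<zeta> i u\<bar> \<le> V v - V u"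
proof -
  have "continuous_on {0..T} (\<zeta> 1)" "continuous_on {0..T} (\<zeta> (Suc i))"
    using \<zeta> by (simp_all add: continuous_levels_def)
  from J_increment[OF this(1) uv] J_increment[OF this(2) uv] A_mono[OF uv] show ?thesis
    unfolding unreflected_def V_def right_diff_distrib by linarith
qed

lemma V_cont: "continuous_on {0..T} V"
  unfolding V_def by (intro continuous_intros A_cont)

lemma unreflected_cont: "continuous_levels \<zeta> \<Longrightarrow> continuous_on {0..T} (unreflected \<zeta> i)"
  using dominated_increments_continuous[OF V_cont, of "unreflected \<zeta> i" 1]
    unreflected_increment by simp

lemma V_mono: "0 \<le> u \<Longrightarrow> u \<le> v \<Longrightarrow> v \<le> T \<Longrightarrow> V u \<le> V v"
  unfolding V_def using A_mono L_nonneg by (simp add: add_mono mult_left_mono)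

section \<open>Lipschitz estimates uniform in the level, and uniqueness\<close>

lemma J_diff_le:
  assumes z: "continuous_on {0..T} z" "continuous_on {0..T} z'" and C: "0 \<le> C"
    and d: "\<And>s. s \<in> {0..T} \<Longrightarrow> \<bar>z s - z' s\<bar> \<le> C * s ^ n" and t: "t \<in> {0..T}"
  shows "\<bar>J z t - J z' t\<bar> \<le> L * C / Suc n * t ^ Suc n"
proof -
  have "z s \<le> z' s + C * s ^ n" "z' s \<le> z s + C * s ^ n" if "0 < s" "s \<le> t" for s
    using d[of s] that t by auto
  then show ?thesis
    using J_compare[OF z C, of 0 t n] J_compare[OF z(2,1) C, of 0 t n] t by (simp add: J_zero)
qed

lemma unreflected_diff_le:
  assumes z: "continuous_levels \<zeta>" "continuous_levels \<zeta>'" and C: "0 \<le> C"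
    and d: "\<And>i s. i \<ge> 1 \<Longrightarrow> s \<in> {0..T} \<Longrightarrow> \<bar>\<zeta> i s - \<zeta>' i s\<bar> \<le> C * s ^ n" and t: "t \<in> {0..T}"
  shows "\<bar>unreflected \<zeta> i t - unreflected \<zeta>' i t\<bar> \<le> 2 * (L * C / Suc n * t ^ Suc n)"
proof -
  have "\<bar>J (\<zeta> j) t - J (\<zeta>' j) t\<bar> \<le> L * C / Suc n * t ^ Suc n" if "j \<ge> 1" for j
    by (rule J_diff_le) (use z C d t that in \<open>auto simp: continuous_levels_def\<close>)
  from this[of 1] this[of "Suc i"] show ?thesis
    unfolding unreflected_def by linarith
qed

text \<open>The bound doubles when the partial sums are reflected, and doubles again when a level is
  taken as the difference of two of them. Neither factor depends on i.\<close>

lemma level_diff_le_of_unreflected: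
  assumes z: "continuous_levels \<zeta>" "continuous_levels \<zeta>'"
    and reg: "regulators \<zeta> \<eta>" "regulators \<zeta>' \<eta>'" and i: "i \<ge> 1" and t: "t \<in> {0..T}"
    and d: "\<And>i s. s \<in> {0..t} \<Longrightarrow> \<bar>unreflected \<zeta> i s - unreflected \<zeta>' i s\<bar> \<le> d"
  shows "\<bar>level \<zeta> \<eta> i t - level \<zeta>' \<eta>' i t\<bar> \<le> 4 * d"
proof -
  have d0: "0 \<le> d" using d[of t] t by (meson abs_ge_zero atLeastAtMost_iff order_refl order_trans)
  have "\<bar>(unreflected \<zeta> j t - \<eta> j t) - (unreflected \<zeta>' j t - \<eta>' j t)\<bar> \<le> 2 * d" for j
  proof (cases "j = 0")
    case True
    then show ?thesis using reg t d0 by (simp add: regulators_def unreflected_def)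
  next
    case False
    then show ?thesis
      using reg z t d unfolding regulators_def
      by (intro regulated_diff_le[where T = T and c = "real j"] unreflected_cont) auto
  qed
  from this[of i] this[of "i - 1"] show ?thesis
    unfolding level_eq[OF i] by linarith
qed

text \<open>The constant is 8 = 2 * 2 * 2: two drift terms in a partial sum, the reflection, the
  difference of two sums. The bound at time s increases with s, so the supremum over [0, t] that the
  reflection demands costs nothing.\<close>

lemma level_diff_le:
  assumes z: "continuous_levels \<zeta>" "continuous_levels \<zeta>'" and C: "0 \<le> C"
    and reg: "regulators \<zeta> \<eta>" "regulators \<zeta>' \<eta>'" and i: "i \<ge> 1" and t: "t \<in> {0..T}"
    and d: "\<And>i s. i \<ge> 1 \<Longrightarrow> s \<in> {0..T} \<Longrightarrow> \<bar>\<zeta> i s - \<zeta>' i s\<bar> \<le> C * s ^ n"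
  shows "\<bar>level \<zeta> \<eta> i t - level \<zeta>' \<eta>' i t\<bar> \<le> 8 * L * C / Suc n * t ^ Suc n"
proof -
  have "\<bar>unreflected \<zeta> j s - unreflected \<zeta>' j s\<bar> \<le> 2 * (L * C / Suc n * t ^ Suc n)"
    if s: "s \<in> {0..t}" for j s
  proof -
    have "\<bar>unreflected \<zeta> j s - unreflected \<zeta>' j s\<bar> \<le> 2 * (L * C / Suc n * s ^ Suc n)"
      by (rule unreflected_diff_le[OF z C d]) (use s t in auto)
    also have "\<dots> \<le> 2 * (L * C / Suc n * t ^ Suc n)"
      using s C L_nonneg by (intro mult_left_mono power_mono) auto
    finally show ?thesis .
  qed
  from level_diff_le_of_unreflected[OF z reg i t this] show ?thesis
    by simp
qed

lemma reflected_unique: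
  assumes r: "reflected \<zeta> \<eta>" "reflected \<zeta>' \<eta>'" and i: "i \<ge> 1" and t: "t \<in> {0..T}"
  shows "\<zeta> i t = \<zeta>' i t"
proof -
  have z: "continuous_levels \<zeta>" "continuous_levels \<zeta>'" and reg: "regulators \<zeta> \<eta>" "regulators \<zeta>' \<eta>'"
    and eq: "\<And>i t. i \<ge> 1 \<Longrightarrow> t \<in> {0..T} \<Longrightarrow> \<zeta> i t = level \<zeta> \<eta> i t"
      "\<And>i t. i \<ge> 1 \<Longrightarrow> t \<in> {0..T} \<Longrightarrow> \<zeta>' i t = level \<zeta>' \<eta>' i t"
    using r by (auto simp: reflected_def)
  \<comment> \<open>The induction starts without an a priori bound on the levels: \<open>J\<close>
    takes values in [0, L * T], so the unreflected sums differ by at most 2 * L * T and the levels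
    by four times that.\<close>
  define B where "B = 8 * L * T"
  have B: "0 \<le> B" using T_nonneg L_nonneg by (simp add: B_def)
  have "\<bar>\<zeta> i t - \<zeta>' i t\<bar> \<le> B * (8 * L) ^ n / fact n * t ^ n" if "i \<ge> 1" "t \<in> {0..T}" for n i t
    using that
  proof (induction n arbitrary: i t)
    case 0
    have J0: "0 \<le> J z s \<and> J z s \<le> L * T" if "continuous_on {0..T} z" "s \<in> {0..T}" for z s
    proof -
      have "L * s \<le> L * T" using that L_nonneg by (intro mult_left_mono) auto
      then show ?thesis using J_increment[OF that(1), of 0 s] that(2) by (simp add: J_zero)
    qed
    have "\<bar>unreflected \<zeta> j s - unreflected \<zeta>' j s\<bar> \<le> 2 * (L * T)" if s: "s \<in> {0..t}" for j s
    proof -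
      have "s \<in> {0..T}" using s 0 by auto
      then show ?thesis
        using J0[of "\<zeta> 1" s] J0[of "\<zeta>' 1" s] J0[of "\<zeta> (Suc j)" s] J0[of "\<zeta>' (Suc j)" s] z
        by (simp add: unreflected_def continuous_levels_def abs_le_iff)
    qed
    from level_diff_le_of_unreflected[OF z reg 0 this] show ?case
      using eq 0 by (simp add: B_def)
  next
    case (Suc n)
    have "\<bar>level \<zeta> \<eta> i t - level \<zeta>' \<eta>' i t\<bar>
        \<le> 8 * L * (B * (8 * L) ^ n / fact n) / Suc n * t ^ Suc n"
      using B L_nonneg by (intro level_diff_le[OF z _ reg Suc.prems Suc.IH]) auto
    then show ?case using eq Suc.prems by (simp add: field_simps)
  qed
  then have "\<bar>\<zeta> i t - \<zeta>' i t\<bar> \<le> B * (8 * L * t) ^ n / fact n" for n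
    using i t by (simp add: power_mult_distrib mult.assoc)
  then have "\<bar>\<zeta> i t - \<zeta>' i t\<bar> \<le> 0"
    by (intro LIMSEQ_le_const[OF exp_term_tendsto_0]) auto
  then show ?thesis by simp
qed

section \<open>Picard iteration\<close>

definition excess :: "(nat \<Rightarrow> real \<Rightarrow> real) \<Rightarrow> nat \<Rightarrow> real \<Rightarrow> real" where
  "excess \<zeta> i = (if i = 0 then A else running_excess (real i) (unreflected \<zeta> i))"

lemma x_sum_le_index: "(\<Sum>j=1..i. x j) \<le> real i"
proof (induction i)
  case (Suc i)
  then show ?case using x_le_1[of i] by simp
qed simp

lemma excess_regulators: "continuous_levels \<zeta> \<Longrightarrow> regulators \<zeta> (excess \<zeta>)"
  unfolding regulators_def
proof (intro conjI ballI allI impI)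
  fix i :: nat assume z: "continuous_levels \<zeta>" and i: "1 \<le> i"
  have "unreflected \<zeta> i 0 \<le> i"
    using x_sum_le_index[of i] by (simp add: unreflected_def J_zero A_zero)
  then show "regulates T (real i) (unreflected \<zeta> i) (excess \<zeta> i)"
    using i by (auto simp: excess_def intro: running_excess_regulates[OF unreflected_increment[OF z] V_cont])
qed (auto simp: excess_def)

lemma excess_increment:
  assumes z: "continuous_levels \<zeta>" and uv: "0 \<le> u" "u \<le> v" "v \<le> T"
  shows "0 \<le> excess \<zeta> i v - excess \<zeta> i u \<and> excess \<zeta> i v - excess \<zeta> i u \<le> V v - V u"
proof (cases "i = 0")
  case True
  have "L * u \<le> L * v" using uv L_nonneg by (intro mult_left_mono) auto
  then show ?thesis using True A_mono[OF uv] by (simp add: excess_def V_def)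
next
  case False
  have "unreflected \<zeta> i 0 \<le> i"
    using x_sum_le_index[of i] by (simp add: unreflected_def J_zero A_zero)
  from running_excess_regulates(2)[OF unreflected_increment[OF z] V_cont this uv] False
  show ?thesis by (simp add: excess_def)
qed

lemma excess_zero: "excess \<zeta> i 0 = 0"
proof (cases "i = 0")
  case False
  then show ?thesis
    using x_sum_le_index[of i]
    by (simp add: excess_def running_excess_def unreflected_def J_zero A_zero)
qed (simp add: excess_def A_zero)

text \<open>One increment of \<open>V\<close> pays for the two drift terms, which enter with
  opposite signs, and the other for the two regulators.\<close>

lemma level_excess_increment:
  assumes z: "continuous_levels \<zeta>" and uv: "0 \<le> u" "u \<le> v" "v \<le> T" and i: "i \<ge> 1"
  shows "\<bar>level \<zeta> (excess \<zeta>) i v - level \<zeta> (excess \<zeta>) i u\<bar> \<le> 2 * (V v - V u)"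
proof -
  have "L * (v - u) \<le> V v - V u"
    using A_mono[OF uv] by (simp add: V_def algebra_simps)
  then show ?thesis
    using J_increment[OF _ uv, of "\<zeta> i"] J_increment[OF _ uv, of "\<zeta> (Suc i)"]
      excess_increment[OF z uv, of i] excess_increment[OF z uv, of "i - 1"] z i
    by (simp add: level_def continuous_levels_def abs_le_iff)
qed

lemma level_zero: "level \<zeta> (excess \<zeta>) i 0 = x i"
  by (simp add: level_def J_zero excess_zero)

lemma level_excess_cont: "continuous_levels \<zeta> \<Longrightarrow> continuous_levels (level \<zeta> (excess \<zeta>))"
  unfolding continuous_levels_def[of "level _ _"]
  by (intro allI impI dominated_increments_continuous[OF V_cont, of _ 2] level_excess_increment)

primrec iterate :: "nat \<Rightarrow> nat \<Rightarrow> real \<Rightarrow> real" where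
  "iterate 0 = (\<lambda>i t. x i)"
| "iterate (Suc n) = level (iterate n) (excess (iterate n))"

lemma iterate_cont: "continuous_levels (iterate n)"
  by (induction n) (simp_all add: level_excess_cont, simp add: continuous_levels_def)

lemma iterate_diff_le:
  assumes "i \<ge> 1" "t \<in> {0..T}"
  shows "\<bar>iterate (Suc n) i t - iterate n i t\<bar> \<le> 2 * V T * (8 * L) ^ n / fact n * t ^ n"
  using assms
proof (induction n arbitrary: i t)
  case 0
  \<comment> \<open>The zeroth iterate is the constant x and the first one starts at x, so their
    distance is an increment of the first one over [0, t].\<close>
  then show ?case
    using level_excess_increment[OF iterate_cont, of 0 t i 0] V_mono[of t T]
    by (simp add: level_zero, simp add: V_def A_zero)
next
  case (Suc n)
  have V: "0 \<le> V T" using V_mono[of 0 T] T_nonneg by (simp add: V_def A_zero)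
  have "\<bar>level (iterate (Suc n)) (excess (iterate (Suc n))) i t
         - level (iterate n) (excess (iterate n)) i t\<bar>
      \<le> 8 * L * (2 * V T * (8 * L) ^ n / fact n) / Suc n * t ^ Suc n"
    using V L_nonneg
    by (intro level_diff_le[OF iterate_cont iterate_cont _ excess_regulators excess_regulators Suc.prems Suc.IH]
        iterate_cont) auto
  then show ?case by (simp add: field_simps)
qed

lemma ex_fixed_point:
  obtains \<zeta> where "continuous_levels \<zeta>"
    "\<And>i t. i \<ge> 1 \<Longrightarrow> t \<in> {0..T} \<Longrightarrow> \<zeta> i t = level \<zeta> (excess \<zeta>) i t"
proof -
  define f where "f n p = iterate (Suc n) (fst p) (snd p) - iterate n (fst p) (snd p)" for n and p :: "nat \<times> real"
  \<comment> \<open>The index is a variable of the M-test along with time: convergence has to be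
    uniform in i, because the Lipschitz estimate for one level assumes a bound on all
    levels.\<close>
  define S where "S = {i::nat. i \<ge> 1} \<times> {0..T}"
  define b where "b n = 2 * V T * (8 * L * T) ^ n / fact n" for n :: nat
  have "summable (\<lambda>n. 2 * V T * (inverse (fact n) * (8 * L * T) ^ n))"
    by (intro summable_mult summable_exp)
  then have sb: "summable b" by (simp add: b_def[abs_def] field_simps)
  have V: "0 \<le> V T" using V_mono[of 0 T] T_nonneg by (simp add: V_def A_zero)
  have fb: "norm (f n p) \<le> b n" if "p \<in> S" for n p
  proof -
    obtain i t where p: "p = (i, t)" by fastforce
    have it: "i \<ge> 1" "t \<in> {0..T}" using that by (auto simp: S_def p)
    have "\<bar>iterate (Suc n) i t - iterate n i t\<bar> \<le> 2 * V T * (8 * L) ^ n / fact n * t ^ n"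
      by (rule iterate_diff_le[OF it])
    also have "\<dots> \<le> 2 * V T * (8 * L) ^ n / fact n * T ^ n"
      using it V L_nonneg by (intro mult_left_mono power_mono) auto
    finally show ?thesis by (simp add: f_def b_def p power_mult_distrib)
  qed
  define \<zeta> where "\<zeta> i t = x i + (\<Sum>n. f n (i, t))" for i t
  have tel: "(\<Sum>k<n. f k (i, t)) = iterate n i t - x i" for n i t
    by (induction n) (auto simp: f_def)
  have ul: "uniform_limit S (\<lambda>n p. \<Sum>k<n. f k p) (\<lambda>p. \<Sum>n. f n p) sequentially"
    by (rule Weierstrass_m_test[OF fb sb])
  have near: "\<exists>N. \<forall>n\<ge>N. \<forall>i\<ge>1. \<forall>t\<in>{0..T}. \<bar>iterate n i t - \<zeta> i t\<bar> < e" if e: "e > 0" for e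
  proof -
    obtain N where N: "\<And>n p. n \<ge> N \<Longrightarrow> p \<in> S \<Longrightarrow> dist (\<Sum>k<n. f k p) (\<Sum>n. f n p) < e"
      using uniform_limitD[OF ul e] by (auto simp: eventually_sequentially)
    have "\<bar>iterate n i t - \<zeta> i t\<bar> < e" if "n \<ge> N" "i \<ge> 1" "t \<in> {0..T}" for n i t
      using N[of n "(i, t)"] that by (simp add: tel dist_real_def \<zeta>_def S_def algebra_simps)
    then show ?thesis by blast
  qed
  have z: "continuous_levels \<zeta>"
    unfolding continuous_levels_def
  proof (intro allI impI)
    fix i :: nat assume i: "i \<ge> 1"
    have "uniform_limit {0..T} (\<lambda>n. iterate n i) (\<zeta> i) sequentially"
      unfolding uniform_limit_iff eventually_sequentially dist_real_def
      using near i by blast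
    then show "continuous_on {0..T} (\<zeta> i)"
      by (rule uniform_limit_theorem[rotated])
        (use iterate_cont i in \<open>auto simp: continuous_levels_def\<close>)
  qed
  have "\<zeta> i t = level \<zeta> (excess \<zeta>) i t" if it: "i \<ge> 1" "t \<in> {0..T}" for i t
  proof -
    \<comment> \<open>The iterate \<open>Suc n\<close> is close to the limit and, by the Lipschitz
      estimate with exponent 0, also to the image of the limit under the level map.\<close>
    have le: "\<bar>\<zeta> i t - level \<zeta> (excess \<zeta>) i t\<bar> \<le> e * (1 + 8 * L * T)" if e: "e > 0" for e
    proof -
      from near[OF e] obtain n where
        n: "\<And>m i t. m \<ge> n \<Longrightarrow> i \<ge> 1 \<Longrightarrow> t \<in> {0..T} \<Longrightarrow> \<bar>iterate m i t - \<zeta> i t\<bar> < e" by blast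
      have "\<bar>level (iterate n) (excess (iterate n)) i t - level \<zeta> (excess \<zeta>) i t\<bar>
          \<le> 8 * L * e / Suc 0 * t ^ Suc 0"
        using n[of n] e by (intro level_diff_le[OF iterate_cont z _ excess_regulators excess_regulators it]
          iterate_cont z) (auto intro: less_imp_le)
      moreover have "\<bar>iterate (Suc n) i t - \<zeta> i t\<bar> < e" using n[of "Suc n"] it by simp
      moreover have "8 * L * e * t \<le> 8 * L * e * T"
        using it e L_nonneg by (intro mult_left_mono) auto
      ultimately show ?thesis by (simp add: algebra_simps)
    qed
    have "\<bar>\<zeta> i t - level \<zeta> (excess \<zeta>) i t\<bar> \<le> 0 + e" if "e > 0" for e
    proof -
      have pos: "0 < 1 + 8 * L * T" using L_nonneg T_nonneg by (simp add: add_pos_nonneg)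
      then show ?thesis using le[of "e / (1 + 8 * L * T)"] that by simp
    qed
    then have "\<bar>\<zeta> i t - level \<zeta> (excess \<zeta>) i t\<bar> \<le> 0" by (rule field_le_epsilon)
    then show ?thesis by simp
  qed
  with z show thesis by (rule that)
qed

section \<open>Order, sign and tails of the fixed point\<close>

lemma level_sum:
  assumes "\<eta> 0 t = A t" and eq: "\<And>i. i \<ge> 1 \<Longrightarrow> \<zeta> i t = level \<zeta> \<eta> i t"
  shows "(\<Sum>j=1..i. \<zeta> j t) = unreflected \<zeta> i t - \<eta> i t"
proof (induction i)
  case 0
  then show ?case using assms(1) by (simp add: unreflected_def)
next
  case (Suc i)
  then show ?case using eq[of "Suc i"] by (simp add: level_eq)
qed

text \<open>After the last time at which level i+1 did not exceed level i, the partial sum of order i lies strictly below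
  its barrier: twice it is less than the sum of its two neighbours, which are at most i-1 and i+1.\<close>

lemma levels_comparison_step:
  assumes r: "reflected \<zeta> \<eta>" and mono: "\<And>i u v. 0 \<le> u \<Longrightarrow> u \<le> v \<Longrightarrow> v \<le> T \<Longrightarrow> \<eta> i u \<le> \<eta> i v"
    and C: "0 \<le> C"
    and le: "\<And>i s. i \<ge> 1 \<Longrightarrow> s \<in> {0..T} \<Longrightarrow> \<zeta> (Suc i) s \<le> \<zeta> i s + C * s ^ n"
    and i: "i \<ge> 1" and t: "t \<in> {0..T}"
  shows "\<zeta> (Suc i) t \<le> \<zeta> i t + L * C / Suc n * t ^ Suc n"
proof (cases "\<zeta> (Suc i) t \<le> \<zeta> i t")
  case True
  moreover have "0 \<le> L * C / Suc n * t ^ Suc n" using C L_nonneg t by simp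
  ultimately show ?thesis by linarith
next
  case False
  have cl: "continuous_levels \<zeta>" and reg: "regulators \<zeta> \<eta>"
    and eq: "\<And>i t. i \<ge> 1 \<Longrightarrow> t \<in> {0..T} \<Longrightarrow> \<zeta> i t = level \<zeta> \<eta> i t"
    using r by (auto simp: reflected_def)
  have A: "\<And>t. t \<in> {0..T} \<Longrightarrow> \<eta> 0 t = A t"
    using reg by (simp add: regulators_def)
  have regi: "\<And>i. i \<ge> 1 \<Longrightarrow> regulates T (real i) (unreflected \<zeta> i) (\<eta> i)"
    using reg by (simp add: regulators_def)
  have cont: "continuous_on {0..T} (\<zeta> j)" if "j \<ge> 1" for j
    using cl that by (simp add: continuous_levels_def)
  define k where "k = i - 1"
  define e where "e = L * C / Suc n * t ^ Suc n"
  have "0 \<le> \<zeta> i 0 - \<zeta> (Suc i) 0"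
  proof -
    have "\<eta> j 0 = 0" for j
      using reg regulatesD(1)[OF regi, of j] T_nonneg A_zero by (cases "j = 0") (auto simp: regulators_def)
    then have "\<zeta> j 0 = x j" if "j \<ge> 1" for j
      using eq[OF that, of 0] T_nonneg by (simp add: level_def J_zero)
    then show ?thesis using x_antimono[of "i - 1"] i by simp
  qed
  moreover have "continuous_on {0..t} (\<lambda>s. \<zeta> i s - \<zeta> (Suc i) s)"
    using cont[of i] cont[of "Suc i"] i t
    by (intro continuous_intros) (auto elim!: continuous_on_subset)
  ultimately obtain u where u: "u \<in> {0..t}" "0 \<le> \<zeta> i u - \<zeta> (Suc i) u"
    "\<And>s. u < s \<Longrightarrow> s \<le> t \<Longrightarrow> \<zeta> i s - \<zeta> (Suc i) s < 0"
    using last_time_above[of t "\<lambda>s. \<zeta> i s - \<zeta> (Suc i) s" 0 0] t by (metis atLeastAtMost_iff order_refl)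
  have ut: "0 \<le> u" "u \<le> t" "t \<le> T" using u t by auto
  have sum_le: "(\<Sum>j=1..k. \<zeta> j s) \<le> real k" if "s \<in> {0..T}" for k s
  proof (cases "k = 0")
    case False
    then show ?thesis
      using level_sum[of \<eta> s \<zeta> k, OF A[OF that] eq[OF _ that]] regulatesD(4)[OF regi, of k s] that by simp
  qed simp
  have "\<eta> i u = \<eta> i t"
  proof (rule regulates_flat[OF regi[OF i] ut])
    fix s assume s: "u < s" "s \<le> t"
    then have sT: "s \<in> {0..T}" using ut by auto
    have split: "(\<Sum>j=1..Suc k. \<zeta> j s) = (\<Sum>j=1..k. \<zeta> j s) + \<zeta> (Suc k) s" for k
      by simp
    have "(\<Sum>j=1..i. \<zeta> j s) = (\<Sum>j=1..i-1. \<zeta> j s) + \<zeta> i s"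
      using split[of "i - 1"] i by simp
    then have "(\<Sum>j=1..i. \<zeta> j s) < real i"
      using sum_le[OF sT, of "i - 1"] sum_le[OF sT, of "Suc i"] split[of i] u(3)[OF s] i
      by (simp add: of_nat_diff)
    then show "unreflected \<zeta> i s - \<eta> i s < real i"
      using level_sum[of \<eta> s \<zeta> i, OF A[OF sT] eq[OF _ sT]] by simp
  qed
  \<comment> \<open>In the difference of neighbouring levels \<open>\<eta> i\<close> has coefficient
    2 and is the only regulator of the wrong sign; its increment has just been shown to vanish. The
    drift terms form a second difference: since level i is below level i + 1 on (u, t], one of the
    two copies of \<open>J (\<zeta> (Suc i))\<close> absorbs \<open>J (\<zeta> i)\<close>, and the
    other one is compared with \<open>J (\<zeta> (Suc (Suc i)))\<close>.\<close>
  then have "\<zeta> (Suc i) t - \<zeta> (Suc i) u - (\<zeta> i t - \<zeta> i u)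
      = (J (\<zeta> (Suc (Suc i))) t - J (\<zeta> (Suc (Suc i))) u) - 2 * (J (\<zeta> (Suc i)) t - J (\<zeta> (Suc i)) u)
        + (J (\<zeta> i) t - J (\<zeta> i) u) - (\<eta> (Suc i) t - \<eta> (Suc i) u) - (\<eta> k t - \<eta> k u)"
    using eq[of i t] eq[of i u] eq[of "Suc i" t] eq[of "Suc i" u] i t ut
    by (simp add: level_def k_def)
  moreover have "J (\<zeta> i) t - J (\<zeta> i) u \<le> J (\<zeta> (Suc i)) t - J (\<zeta> (Suc i)) u"
    using J_compare[of "\<zeta> i" "\<zeta> (Suc i)" 0 u t 0] cont[of i] cont[of "Suc i"] i ut u(3) by force
  moreover have "J (\<zeta> (Suc (Suc i))) t - J (\<zeta> (Suc (Suc i))) u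
      \<le> J (\<zeta> (Suc i)) t - J (\<zeta> (Suc i)) u + e"
  proof -
    have "J (\<zeta> (Suc (Suc i))) t - J (\<zeta> (Suc (Suc i))) u
        \<le> J (\<zeta> (Suc i)) t - J (\<zeta> (Suc i)) u + L * C / Suc n * (t ^ Suc n - u ^ Suc n)"
      by (rule J_compare) (use cont C ut le in auto)
    moreover have "L * C / Suc n * (t ^ Suc n - u ^ Suc n) \<le> e"
      unfolding e_def using C L_nonneg ut by (intro mult_left_mono) auto
    ultimately show ?thesis by (rule order_trans[OF _ add_left_mono])
  qed
  moreover have "\<eta> (Suc i) u \<le> \<eta> (Suc i) t" "\<eta> k u \<le> \<eta> k t"
    using mono ut by auto
  ultimately have "\<zeta> (Suc i) t - \<zeta> (Suc i) u - (\<zeta> i t - \<zeta> i u) \<le> e" by argo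
  then have "\<zeta> (Suc i) t \<le> \<zeta> i t + e" using u(2) by argo
  then show ?thesis by (simp add: e_def)
qed

lemma J_le: "continuous_on {0..T} z \<Longrightarrow> t \<in> {0..T} \<Longrightarrow> 0 \<le> J z t \<and> J z t \<le> L * T"
proof -
  assume z: "continuous_on {0..T} z" and t: "t \<in> {0..T}"
  have "L * t \<le> L * T" using t L_nonneg by (intro mult_left_mono) auto
  then show ?thesis using J_increment[OF z, of 0 t] t by (simp add: J_zero)
qed

text \<open>The last two conclusions prepare continuity in the sequence space: from index
  \<open>K\<close> on nothing is reflected, and the tails are dominated by those of x at all times
  at once.\<close>

theorem reflected_exists:
  obtains \<zeta> \<eta> K where "reflected \<zeta> \<eta>"
    and "\<And>i t. i \<ge> 1 \<Longrightarrow> t \<in> {0..T} \<Longrightarrow> 0 \<le> \<zeta> i t \<and> \<zeta> i t \<le> 1 \<and> \<zeta> (Suc i) t \<le> \<zeta> i t"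
    and "\<And>i u v. 0 \<le> u \<Longrightarrow> u \<le> v \<Longrightarrow> v \<le> T \<Longrightarrow> 0 \<le> \<eta> i v - \<eta> i u \<and> \<eta> i v - \<eta> i u \<le> V v - V u"
    and "\<And>i t. K \<le> i \<Longrightarrow> t \<in> {0..T} \<Longrightarrow> \<eta> i t = 0"
    and "\<And>N m t. t \<in> {0..T} \<Longrightarrow> K \<le> N \<Longrightarrow> (\<Sum>j=Suc N..m. \<zeta> j t) \<le> (\<Sum>j=Suc N..m. x j)"
proof -
  obtain \<zeta> where cl: "continuous_levels \<zeta>"
    and eq: "\<And>i t. i \<ge> 1 \<Longrightarrow> t \<in> {0..T} \<Longrightarrow> \<zeta> i t = level \<zeta> (excess \<zeta>) i t"
    using ex_fixed_point by blast
  define \<eta> where "\<eta> = excess \<zeta>"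
  have reg: "regulators \<zeta> \<eta>" unfolding \<eta>_def by (rule excess_regulators[OF cl])
  have r: "reflected \<zeta> \<eta>" using cl reg eq by (simp add: reflected_def \<eta>_def)
  have incr: "0 \<le> \<eta> i v - \<eta> i u \<and> \<eta> i v - \<eta> i u \<le> V v - V u"
    if "0 \<le> u" "u \<le> v" "v \<le> T" for i u v
    unfolding \<eta>_def by (rule excess_increment[OF cl that])
  have mono: "\<eta> i u \<le> \<eta> i v" if "0 \<le> u" "u \<le> v" "v \<le> T" for i u v
    using incr[OF that, of i] by simp
  have cont: "continuous_on {0..T} (\<zeta> j)" if "j \<ge> 1" for j
    using cl that by (simp add: continuous_levels_def)
  have \<eta>0: "\<eta> i 0 = 0" for i by (simp add: \<eta>_def excess_zero)
  have sum: "(\<Sum>j=1..i. \<zeta> j t) = unreflected \<zeta> i t - \<eta> i t" if "t \<in> {0..T}" for i t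
    using level_sum[of \<eta> t \<zeta> i] eq[OF _ that] reg that by (simp add: \<eta>_def regulators_def)
  \<comment> \<open>Each level stays within 2 * V T of its initial value, and the initial values are
    ordered, so two neighbours are out of order by at most 4 * V T. This starts the induction on
    powers of t.\<close>
  define B where "B = 4 * V T"
  have VT: "0 \<le> V T" using V_mono[of 0 T] T_nonneg by (simp add: V_def A_zero)
  have close: "\<bar>\<zeta> i t - x i\<bar> \<le> 2 * V T" if it: "i \<ge> 1" "t \<in> {0..T}" for i t
    using level_excess_increment[OF cl, of 0 t i] it V_mono[of t T] eq[OF it]
    by (simp add: level_zero, simp add: V_def A_zero)
  have "\<zeta> (Suc i) t \<le> \<zeta> i t + B * L ^ n / fact n * t ^ n" if "i \<ge> 1" "t \<in> {0..T}" for i t n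
    using that
  proof (induction n arbitrary: i t)
    case 0
    have "x (Suc i) \<le> x i" using x_antimono[of "i - 1"] 0 by simp
    then show ?case using close[of i t] close[of "Suc i" t] 0 by (simp add: B_def)
  next
    case (Suc n)
    have "\<zeta> (Suc i) t \<le> \<zeta> i t + L * (B * L ^ n / fact n) / Suc n * t ^ Suc n"
      using VT L_nonneg by (intro levels_comparison_step[OF r mono _ Suc.IH Suc.prems]) (auto simp: B_def)
    then show ?case by (simp add: field_simps)
  qed
  then have dec: "\<zeta> (Suc i) t \<le> \<zeta> i t" if "i \<ge> 1" "t \<in> {0..T}" for i t
  proof -
    have "\<zeta> (Suc i) t - \<zeta> i t \<le> B * (L * t) ^ n / fact n" for n
      using \<open>\<And>t n i. 1 \<le> i \<Longrightarrow> t \<in> {0..T} \<Longrightarrow> \<zeta> (Suc i) t \<le> \<zeta> i t + B * L ^ n / fact n * t ^ n\<close>[OF that, of n]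
      by (simp add: power_mult_distrib algebra_simps)
    then have "\<zeta> (Suc i) t - \<zeta> i t \<le> 0"
      by (intro LIMSEQ_le_const[OF exp_term_tendsto_0]) auto
    then show ?thesis by simp
  qed
  have dec': "\<zeta> j t \<le> \<zeta> i t" if "i \<ge> 1" "i \<le> j" "t \<in> {0..T}" for i j t
    using that(2) by (induction j rule: dec_induct) (use dec[OF _ that(3)] that(1) in \<open>auto intro: order_trans\<close>)
  \<comment> \<open>The unreflected partial sums are bounded by M + A T + L * T for all i, whereas
    the barrier i grows; from this \<open>K\<close> on it is never reached.\<close>
  obtain K :: nat where K: "M + A T + L * T < real K" "K \<ge> 1"
    by (metis le_add2 of_nat_mono order_less_le_trans reals_Archimedean2 trans_le_add1)
  have \<eta>K: "\<eta> i t = 0" if i: "i \<ge> K" and t: "t \<in> {0..T}" for i t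
  proof -
    have "unreflected \<zeta> i s - \<eta> i s < real i" if s: "s \<in> {0..T}" for s
    proof -
      have "0 \<le> \<eta> i s" using mono[of 0 s i] \<eta>0 s by simp
      moreover have "A s \<le> A T" using A_mono[of s T] s by simp
      ultimately show ?thesis
        using x_sum_le[of i] J_le[OF cont s, of 1] J_le[OF cont s, of "Suc i"] K i
        by (simp add: unreflected_def)
    qed
    moreover have "regulates T (real i) (unreflected \<zeta> i) (\<eta> i)"
      using reg K i by (simp add: regulators_def)
    ultimately have "\<eta> i 0 = \<eta> i t" using regulates_flat[of T "real i" "unreflected \<zeta> i" "\<eta> i" 0 t] t by auto
    then show ?thesis using \<eta>0 by simp
  qed
  have nonneg: "0 \<le> \<zeta> i t" if i: "i \<ge> 1" and t: "t \<in> {0..T}" for i t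
  proof (rule ccontr)
    assume neg: "\<not> 0 \<le> \<zeta> i t"
    define N where "N = max i K"
    \<comment> \<open>A negative level would bound all later ones from above and drive the partial
      sums to minus infinity. From \<open>K\<close> on, however, the partial sums are free of
      reflection and at least - L * T.\<close>
    have drop: "(\<Sum>j=1..N+k. \<zeta> j t) \<le> (\<Sum>j=1..N. \<zeta> j t) + real k * \<zeta> i t" for k
    proof (induction k)
      case (Suc k)
      moreover have "\<zeta> (Suc (N + k)) t \<le> \<zeta> i t" using dec'[OF i _ t] by (simp add: N_def)
      ultimately show ?case by (simp add: algebra_simps)
    qed simp
    obtain k :: nat where k: "(\<Sum>j=1..N. \<zeta> j t) + L * T < real k * (- \<zeta> i t)"
      using reals_Archimedean3[of "- \<zeta> i t"] neg by auto
    have "0 \<le> (\<Sum>j=1..N+k. x j)"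
      by (intro sum_nonneg) (metis One_nat_def Suc_le_D atLeastAtMost_iff x_nonneg)
    moreover have "0 \<le> A t" using A_mono[of 0 t] t A_zero by simp
    ultimately have "- (L * T) \<le> (\<Sum>j=1..N+k. \<zeta> j t)"
      using sum[OF t, of "N + k"] \<eta>K[of "N + k" t] t J_le[OF cont t, of 1] J_le[OF cont t, of "Suc (N + k)"]
      by (simp add: unreflected_def N_def)
    then show False using drop[of k] k by simp
  qed
  have le1: "\<zeta> i t \<le> 1" if i: "i \<ge> 1" and t: "t \<in> {0..T}" for i t
  proof -
    have "regulates T (real 1) (unreflected \<zeta> 1) (\<eta> 1)" using reg by (auto simp: regulators_def)
    from regulatesD(4)[OF this, of t] have "\<zeta> 1 t \<le> 1" using sum[OF t, of 1] t by simp
    then show ?thesis using dec'[of 1 i t] i t by simp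
  qed
  have tail: "(\<Sum>j=Suc N..m. \<zeta> j t) \<le> (\<Sum>j=Suc N..m. x j)" if t: "t \<in> {0..T}" and N: "K \<le> N" for N m t
  proof (cases "N \<le> m")
    case True
    have s: "(\<Sum>j=Suc N..m. f j) = (\<Sum>j=1..m. f j) - (\<Sum>j=1..N. f j)" for f :: "nat \<Rightarrow> real"
      using True sum.ub_add_nat[of 1 N f "m - N"] by simp
    \<comment> \<open>With both regulators zero, the partial sums of orders m and N differ by the
      tail of x plus a difference of drifts, which the order of the levels makes
      nonpositive.\<close>
    have "J (\<zeta> (Suc m)) t \<le> J (\<zeta> (Suc N)) t"
      using J_compare[OF cont cont, of "Suc m" "Suc N" 0 0 t 0] dec'[of "Suc N" "Suc m"] t True
      by (simp add: J_zero)
    then show ?thesis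
      unfolding s sum[OF t] using \<eta>K[of m t] \<eta>K[of N t] t True N by (simp add: unreflected_def)
  qed simp
  show thesis
    by (rule that[of \<zeta> \<eta> K]) (use r incr dec nonneg le1 tail \<eta>K in auto)
qed

text \<open>All levels are at most 1, so a partial sum of order i can reach i only if its last term
  is 1.\<close>

lemma reflected_flat:
  assumes r: "reflected \<zeta> \<eta>" and le: "\<And>i t. i \<ge> 1 \<Longrightarrow> t \<in> {0..T} \<Longrightarrow> \<zeta> i t \<le> 1"
    and i: "i \<ge> 1" and ab: "0 \<le> a" "a \<le> b" "b \<le> T" and less: "\<And>s. a \<le> s \<Longrightarrow> s \<le> b \<Longrightarrow> \<zeta> i s < 1"
  shows "\<eta> i a = \<eta> i b"
proof (rule regulatesD(5)[OF _ ab])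
  show "regulates T (real i) (unreflected \<zeta> i) (\<eta> i)"
    using r i by (simp add: reflected_def regulators_def)
  fix s assume s: "a \<le> s" "s \<le> b"
  then have sT: "s \<in> {0..T}" using ab by auto
  have "(\<Sum>j=1..i-1. \<zeta> j s) \<le> (\<Sum>j=1..i-1. 1)" using le sT by (intro sum_mono) auto
  moreover have "(\<Sum>j=1..i. \<zeta> j s) = (\<Sum>j=1..i-1. \<zeta> j s) + \<zeta> i s"
    using i by (cases i) auto
  ultimately have "(\<Sum>j=1..i. \<zeta> j s) < real i" using less[OF s] i by (simp add: of_nat_diff)
  then show "unreflected \<zeta> i s - \<eta> i s < real i"
    using level_sum[of \<eta> s \<zeta> i] r sT by (simp add: reflected_def regulators_def)
qed

text \<open>The converse translation rests on the order: if level i equals 1, so do all levels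
  before it, and the partial sum of order i is at its barrier. This makes any solution of the stated
  problem comparable with the constructed one.\<close>

lemma reflectedI:
  assumes cl: "continuous_levels \<zeta>" and A: "\<And>t. t \<in> {0..T} \<Longrightarrow> \<eta> 0 t = A t"
    and eq: "\<And>i t. i \<ge> 1 \<Longrightarrow> t \<in> {0..T} \<Longrightarrow> \<zeta> i t = level \<zeta> \<eta> i t"
    and \<zeta>: "\<And>i t. i \<ge> 1 \<Longrightarrow> t \<in> {0..T} \<Longrightarrow> \<zeta> i t \<le> 1 \<and> \<zeta> (Suc i) t \<le> \<zeta> i t"
    and \<eta>: "\<And>i. i \<ge> 1 \<Longrightarrow> \<eta> i 0 = 0 \<and> mono_on {0..T} (\<eta> i) \<and> continuous_on {0..T} (\<eta> i)"
    and flat: "\<And>i a b. i \<ge> 1 \<Longrightarrow> 0 \<le> a \<Longrightarrow> a \<le> b \<Longrightarrow> b \<le> T \<Longrightarrow>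
      (\<And>s. a \<le> s \<Longrightarrow> s \<le> b \<Longrightarrow> \<zeta> i s < 1) \<Longrightarrow> \<eta> i a = \<eta> i b"
  shows "reflected \<zeta> \<eta>"
proof -
  have sum: "unreflected \<zeta> i t - \<eta> i t = (\<Sum>j=1..i. \<zeta> j t)" if "t \<in> {0..T}" for i t
    using level_sum[of \<eta> t \<zeta> i, OF A[OF that] eq[OF _ that]] by simp
  have dec: "\<zeta> i t \<le> \<zeta> j t" if "j \<ge> 1" "j \<le> i" "t \<in> {0..T}" for i j t
    using that(2) by (induction i rule: dec_induct) (use \<zeta>[OF _ that(3)] that(1) in \<open>auto intro: order_trans\<close>)
  have "regulates T (real i) (unreflected \<zeta> i) (\<eta> i)" if i: "i \<ge> 1" for i
    unfolding regulates_def
  proof (intro conjI ballI allI impI)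
    show "unreflected \<zeta> i t - \<eta> i t \<le> real i" if t: "t \<in> {0..T}" for t
    proof -
      have "(\<Sum>j=1..i. \<zeta> j t) \<le> (\<Sum>j=1..i. 1)" using \<zeta> t by (intro sum_mono) auto
      then show ?thesis using sum[OF t, of i] by simp
    qed
    show "\<eta> i a = \<eta> i b" if ab: "0 \<le> a" "a \<le> b" "b \<le> T"
      and less: "\<forall>s\<in>{a..b}. unreflected \<zeta> i s - \<eta> i s < real i" for a b
    proof (rule flat[OF i ab], rule ccontr)
      fix s assume s: "a \<le> s" "s \<le> b" "\<not> \<zeta> i s < 1"
      then have sT: "s \<in> {0..T}" using ab by auto
      have "(\<Sum>j=1..i. 1) \<le> (\<Sum>j=1..i. \<zeta> j s)"
        using dec[of _ i s] sT s by (intro sum_mono) force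
      moreover have "unreflected \<zeta> i s - \<eta> i s < real i" using less s by simp
      ultimately show False using sum[OF sT, of i] by simp
    qed
  qed (use \<eta>[OF i] in auto)
  then show ?thesis using cl A eq by (simp add: reflected_def regulators_def)
qed

end

section \<open>The service drift\<close>

lemma strip_cbox: "strip t = cbox (0, 0) (t, 1)"
  by (auto simp: strip_def cbox_Pair_eq)

lemma strip_sets [measurable]: "strip t \<in> sets borel"
  by (simp add: strip_cbox)

lemma strip_sets_pair [measurable]: "strip t \<in> sets (borel \<Otimes>\<^sub>M borel)"
  using strip_sets[of t] by (simp only: borel_prod)

lemma measure_strip: "0 \<le> t \<Longrightarrow> measure lborel (strip t) = t"
  unfolding strip_cbox by (subst measure_lborel_cbox_eq) (auto simp: Basis_prod_def)

lemma emeasure_strip: "emeasure lborel (strip t) < \<infinity>"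
  unfolding strip_cbox by (simp add: emeasure_lborel_cbox_eq)

lemma integrable_strip: "integrable lborel (indicator (strip t) :: _ \<Rightarrow> real)"
  using emeasure_strip[of t] by (intro integrable_real_indicator) auto

lemma strip_mono: "u \<le> v \<Longrightarrow> strip u \<subseteq> strip v"
  by (auto simp: strip_def)

lemma integrable_bounded_on_strip:
  fixes g :: "real \<times> real \<Rightarrow> real"
  assumes "g \<in> borel_measurable borel" and "\<And>p. \<bar>g p\<bar> \<le> C * indicator (strip T) p"
  shows "integrable lborel g"
proof (rule Bochner_Integration.integrable_bound)
  show "integrable lborel (\<lambda>p. C * indicator (strip T) p :: real)"
    using integrable_strip by (intro integrable_mult_right)
  show "AE p in lborel. norm (g p) \<le> norm (C * indicator (strip T) p :: real)"
    using assms(2) by (intro AE_I2) (metis abs_ge_self order_trans real_norm_def)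
qed (use assms(1) in simp)

lemma strip_integral_0: "(LINT p:strip 0|lborel. f p) = (0 :: real)"
proof -
  have "emeasure lborel (strip 0) = 0"
    using measure_strip[of 0] emeasure_strip[of 0] by (simp add: emeasure_eq_ennreal_measure less_top)
  then have "strip 0 \<in> null_sets lborel" by auto
  then have "AE p in lborel. indicator (strip 0) p *\<^sub>R f p = 0"
    by (rule AE_not_in[THEN AE_mp]) auto
  then show ?thesis unfolding set_lebesgue_integral_def by (rule integral_eq_zero_AE)
qed

text \<open>Paths are controlled only on [0, T], while measurability in the plane calls for
  functions on the whole line; freezing the path outside [0, T] supplies them.\<close>

lemma continuous_on_clamp:
  fixes z :: "real \<Rightarrow> real"
  assumes "continuous_on {0..T} z" "0 \<le> T"
  shows "continuous_on UNIV (\<lambda>s. z (max 0 (min T s)))"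
  by (rule continuous_on_compose2[OF assms(1)]) (auto intro!: continuous_intros simp: assms)

lemma integral_pair_real:
  fixes g :: "real \<times> real \<Rightarrow> real"
  assumes "integrable lborel g"
  shows "(\<integral>p. g p \<partial>lborel) = (\<integral>s. (\<integral>y. g (s, y) \<partial>lborel) \<partial>lborel)"
    and "integrable lborel (\<lambda>s. \<integral>y. g (s, y) \<partial>lborel)"
  using lborel_pair.integral_fst'[of g] lborel_pair.integrable_fst'[of g] assms
  by (simp_all add: lborel_prod)

locale service =
  fixes T L :: real and \<theta> :: "real \<times> real \<Rightarrow> real"
  assumes T_pos: "0 < T" and theta: "\<theta> \<in> nonneg_measurable T"
    and theta_le: "\<And>p. p \<in> strip T \<Longrightarrow> \<theta> p \<le> L"
begin

text \<open>\<theta> is measurable only relative to the strip. The extension by 0 is Borel on the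
  plane and can be composed with shifts that leave the strip.\<close>

definition theta0 :: "real \<times> real \<Rightarrow> real" where
  "theta0 p = indicator (strip T) p * \<theta> p"

text \<open>The cumulative service above level 1 - z, so that for z' \<le> z in [0, 1] the drift terms of the
  equations are the differences of J z and J z'.\<close>

definition J :: "(real \<Rightarrow> real) \<Rightarrow> real \<Rightarrow> real" where
  "J z t = (LINT (s, y):strip t|lborel. indicator {1 - z s..1} y * \<theta> (s, y))"

lemma theta0_measurable: "theta0 \<in> borel_measurable borel"
proof -
  have "(\<lambda>p. indicator (strip T) p *\<^sub>R \<theta> p) \<in> borel_measurable borel"
    using theta by (subst borel_measurable_restrict_space_iff[symmetric]) (auto simp: nonneg_measurable_def)
  then show ?thesis by (simp add: theta0_def[abs_def])
qed

lemma theta0_measurable_pair [measurable]: "theta0 \<in> borel_measurable (borel \<Otimes>\<^sub>M borel)"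
  using theta0_measurable by (simp only: borel_prod)

lemma theta_nonneg: "p \<in> strip T \<Longrightarrow> 0 \<le> \<theta> p"
  using theta by (simp add: nonneg_measurable_def)

lemma L_nonneg: "0 \<le> L"
  using theta_nonneg[of "(0, 0)"] theta_le[of "(0, 0)"] T_pos by (simp add: strip_def)

definition slab :: "(real \<Rightarrow> real) \<Rightarrow> real \<Rightarrow> real \<times> real \<Rightarrow> real" where
  "slab z t p = indicator (strip t) p * indicator {1 - z (fst p)..1} (snd p) * \<theta> p"

lemma J_eq_slab: "J z t = (\<integral>p. slab z t p \<partial>lborel)"
  unfolding J_def set_lebesgue_integral_def slab_def
  by (intro Bochner_Integration.integral_cong) (auto simp: mult.assoc split: prod.split)

lemma slab_integrable:
  assumes z: "continuous_on {0..T} z" and t: "t \<in> {0..T}"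
  shows "integrable lborel (slab z t)"
proof (rule integrable_bounded_on_strip[where C = L])
  define w where "w s = z (max 0 (min T s))" for s
  have w [measurable]: "w \<in> borel_measurable borel"
    unfolding w_def using continuous_on_clamp[OF z] T_pos by (intro borel_measurable_continuous_onI) auto
  have "slab z t = (\<lambda>p. indicator (strip t) p * (indicator {p. 1 - w (fst p) \<le> snd p \<and> snd p \<le> 1} p * theta0 p))"
    using t by (intro ext) (auto simp: slab_def theta0_def strip_def w_def split: split_indicator)
  also have "\<dots> \<in> borel_measurable (borel \<Otimes>\<^sub>M borel)"
    by measurable
  finally show "slab z t \<in> borel_measurable borel" by (simp only: borel_prod)
  show "\<bar>slab z t p\<bar> \<le> L * indicator (strip T) p" for p
    using theta_nonneg[of p] theta_le[of p] strip_mono[of t T] t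
    by (auto simp: slab_def split: split_indicator)
qed

lemma J_increment:
  assumes z: "continuous_on {0..T} z" and uv: "0 \<le> u" "u \<le> v" "v \<le> T"
  shows "0 \<le> J z v - J z u \<and> J z v - J z u \<le> L * (v - u)"
proof -
  have i: "integrable lborel (slab z u)" "integrable lborel (slab z v)"
    using slab_integrable[OF z] uv by auto
  have J: "J z v - J z u = (\<integral>p. slab z v p - slab z u p \<partial>lborel)"
    using i by (simp add: J_eq_slab)
  have sub: "p \<in> strip u \<Longrightarrow> p \<in> strip v" "p \<in> strip v \<Longrightarrow> p \<in> strip T" for p
    using strip_mono uv by blast+
  have "0 \<le> slab z v p - slab z u p" for p
    using sub theta_nonneg by (auto simp: slab_def split: split_indicator)
  then have "0 \<le> J z v - J z u" unfolding J by simp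
  moreover have "J z v - J z u \<le> (\<integral>p. L * (indicator (strip v) p - indicator (strip u) p) \<partial>lborel)"
    unfolding J
  proof (rule integral_mono)
    show "slab z v p - slab z u p \<le> L * (indicator (strip v) p - indicator (strip u) p)" for p
      using sub[of p] theta_le[of p] theta_nonneg[of p] L_nonneg by (auto simp: slab_def split: split_indicator)
  qed (use i integrable_strip in auto)
  moreover have "(\<integral>p. L * (indicator (strip v) p - indicator (strip u) p) \<partial>lborel) = L * (v - u)"
    using uv by (simp add: integrable_strip measure_strip)
  ultimately show ?thesis by argo
qed

text \<open>The extra service under z comes from the region between the graphs of 1 - z' - C * s ^ n
  and 1 - z'. Its section at time s has length at most C * s ^ n and the intensity is at most L, so
  integration over [u, v] gives the next power.\<close>

lemma J_compare:
  assumes z: "continuous_on {0..T} z" "continuous_on {0..T} z'" and C: "0 \<le> C"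
    and uv: "0 \<le> u" "u \<le> v" "v \<le> T"
    and le: "\<And>s. u < s \<Longrightarrow> s \<le> v \<Longrightarrow> z s \<le> z' s + C * s ^ n"
  shows "J z v - J z u \<le> J z' v - J z' u + L * C / Suc n * (v ^ Suc n - u ^ Suc n)"
proof -
  define w where "w s = z' (max 0 (min T s))" for s
  have w[measurable]: "w \<in> borel_measurable borel"
    unfolding w_def using continuous_on_clamp[OF z(2)] T_pos by (intro borel_measurable_continuous_onI) auto
  define R where "R = {p :: real \<times> real. u \<le> fst p \<and> fst p \<le> v \<and>
      0 \<le> snd p \<and> snd p \<le> 1 \<and> 1 - w (fst p) - C * fst p ^ n \<le> snd p \<and> snd p < 1 - w (fst p)}"
  have "Measurable.pred (borel \<Otimes>\<^sub>M borel) (\<lambda>p. p \<in> R)"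
    unfolding R_def mem_Collect_eq by measurable
  then have R: "R \<in> sets borel"
    by (simp add: pred_sets2 borel_prod pred_def)
  have iR: "integrable lborel (indicator R :: _ \<Rightarrow> real)"
    by (rule integrable_bounded_on_strip[where C = 1 and T = T])
      (use R uv in \<open>auto simp: R_def strip_def split: split_indicator\<close>)
  have i: "integrable lborel (slab z u)" "integrable lborel (slab z v)"
    "integrable lborel (slab z' u)" "integrable lborel (slab z' v)"
    using slab_integrable z uv by auto
  have sub: "p \<in> strip u \<Longrightarrow> p \<in> strip v" "p \<in> strip v \<Longrightarrow> p \<in> strip T" for p
    using strip_mono uv by blast+
  have "(J z v - J z u) - (J z' v - J z' u)
      = (\<integral>p. (slab z v p - slab z u p) - (slab z' v p - slab z' u p) \<partial>lborel)"
    using i by (simp add: J_eq_slab)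
  also have "\<dots> \<le> (\<integral>p. L * indicator R p \<partial>lborel)"
  proof (rule integral_mono)
    fix p :: "real \<times> real"
    obtain s y where p: "p = (s, y)" by fastforce
    show "(slab z v p - slab z u p) - (slab z' v p - slab z' u p) \<le> L * indicator R p"
    \<comment> \<open>Only times after u matter: points at time u itself already belong to
      \<open>strip u\<close>, which matches the half-open range of the hypothesis on z and
      z'.\<close>
    proof (cases "p \<in> strip v \<and> p \<notin> strip u")
      case True
      then have s: "u < s" "s \<le> v" "0 \<le> y" "y \<le> 1" using uv by (auto simp: p strip_def)
      then have "w s = z' s" using uv by (simp add: w_def)
      then show ?thesis
        using True theta_nonneg[of p] theta_le[of p] sub[of p] le[OF s(1,2)] s L_nonneg
        by (auto simp: p slab_def R_def split: split_indicator)
    next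
      case False
      then have "slab z v p = slab z u p" "slab z' v p = slab z' u p"
        using sub(1)[of p] by (auto simp: slab_def split: split_indicator)
      then show ?thesis using L_nonneg by (simp split: split_indicator)
    qed
  qed (use i iR in auto)
  also have "\<dots> = L * (\<integral>p. indicat_real R p \<partial>lborel)" by simp
  also have "(\<integral>p. indicat_real R p \<partial>lborel) = (\<integral>s. (\<integral>y. indicat_real R (s, y) \<partial>lborel) \<partial>lborel)"
    by (rule integral_pair_real(1)[OF iR])
  also have "\<dots> \<le> (\<integral>s. C * (s ^ n * indicator {u..v} s) \<partial>lborel)"
  proof (rule integral_mono)
    show "integrable lborel (\<lambda>s. \<integral>y. indicat_real R (s, y) \<partial>lborel)"
      by (rule integral_pair_real(2)[OF iR])
    show "integrable lborel (\<lambda>s. C * (s ^ n * indicator {u..v} s))"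
      using borel_integrable_atLeastAtMost'[of u v "\<lambda>s. s ^ n", OF continuous_on_power[OF continuous_on_id]]
      by (simp add: set_integrable_def mult.commute)
    fix s :: real
    have "(\<integral>y. indicat_real R (s, y) \<partial>lborel)
        \<le> (\<integral>y. indicator {u..v} s * indicator {1 - w s - C * s ^ n..<1 - w s} y \<partial>lborel)"
      using C uv by (intro integral_mono')
        (auto simp: R_def intro!: integrable_real_indicator integrable_mult_right split: split_indicator)
    also have "\<dots> = C * (s ^ n * indicator {u..v} s)"
      using C uv by (auto split: split_indicator)
    finally show "(\<integral>y. indicat_real R (s, y) \<partial>lborel) \<le> C * (s ^ n * indicator {u..v} s)" .
  qed
  also have "\<dots> = C * ((v ^ Suc n - u ^ Suc n) / Suc n)"
    by (simp add: integral_power uv)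
  finally have "(J z v - J z u) - (J z' v - J z' u) \<le> L * (C * ((v ^ Suc n - u ^ Suc n) / Suc n))"
    using L_nonneg mult_left_mono by blast
  also have "\<dots> = L * C / Suc n * (v ^ Suc n - u ^ Suc n)" by simp
  finally show ?thesis by argo
qed

lemma J_zero: "J z 0 = 0"
  unfolding J_def by (rule strip_integral_0)

lemma J_diff:
  assumes z: "continuous_on {0..T} z" "continuous_on {0..T} z'" and t: "t \<in> {0..T}"
    and le: "\<And>s. s \<in> {0..T} \<Longrightarrow> 0 \<le> z' s \<and> z' s \<le> z s"
  shows "(LINT (s, y):strip t|lborel. indicator {1 - z s..<1 - z' s} y * \<theta> (s, y)) = J z t - J z' t"
    and "integrable lborel (\<lambda>(s, y). indicator (strip t) (s, y) * (indicator {1 - z s..<1 - z' s} y * \<theta> (s, y)))"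
proof -
  have eq: "indicator (strip t) (s, y) * (indicator {1 - z s..<1 - z' s} y * \<theta> (s, y))
      = slab z t (s, y) - slab z' t (s, y)" for s y
    using le[of s] t by (auto simp: slab_def strip_def split: split_indicator)
  then have eq': "(\<lambda>(s, y). indicator (strip t) (s, y) * (indicator {1 - z s..<1 - z' s} y * \<theta> (s, y)))
      = (\<lambda>p. slab z t p - slab z' t p)"
    by (auto simp: fun_eq_iff)
  have i: "integrable lborel (slab z t)" "integrable lborel (slab z' t)"
    using slab_integrable z t by auto
  have "(LINT (s, y):strip t|lborel. indicator {1 - z s..<1 - z' s} y * \<theta> (s, y))
      = (\<integral>p. slab z t p - slab z' t p \<partial>lborel)"
    unfolding set_lebesgue_integral_def eq'[symmetric]
    by (intro Bochner_Integration.integral_cong) auto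
  also have "\<dots> = J z t - J z' t"
    using i by (simp add: J_eq_slab)
  finally show "(LINT (s, y):strip t|lborel. indicator {1 - z s..<1 - z' s} y * \<theta> (s, y)) = J z t - J z' t" .
  show "integrable lborel (\<lambda>(s, y). indicator (strip t) (s, y) * (indicator {1 - z s..<1 - z' s} y * \<theta> (s, y)))"
    unfolding eq' using i by simp
qed

end

section \<open>Translated controls\<close>

context service
begin

lemma shift_measurable:
  assumes z: "continuous_on {0..T} z" "continuous_on {0..T} z'"
    and le: "\<And>s. s \<in> {0..T} \<Longrightarrow> 0 \<le> z' s \<and> z' s \<le> z s \<and> z s \<le> 1"
  shows "(\<lambda>(s, y). \<theta> (s, y + 1 - z s) * indicator {0..<z s - z' s} y + indicator {z s - z' s..<1} y)
    \<in> nonneg_measurable T"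
proof -
  define w where "w s = z (max 0 (min T s))" for s
  define w' where "w' s = z' (max 0 (min T s))" for s
  have [measurable]: "w \<in> borel_measurable borel" "w' \<in> borel_measurable borel"
    unfolding w_def w'_def using continuous_on_clamp[OF z(1)] continuous_on_clamp[OF z(2)] T_pos
    by (auto intro: borel_measurable_continuous_onI)
  define f where "f = (\<lambda>(s, y). \<theta> (s, y + 1 - z s) * indicator {0..<z s - z' s} y + indicator {z s - z' s..<1} y)"
  \<comment> \<open>\<open>theta0\<close> agrees with \<theta> wherever the first indicator is 1:
    for 0 \<le> y < z - z' the shifted point lies in [1 - z, 1 - z'), inside [0, 1].\<close>
  define g where "g p = theta0 (fst p, snd p + 1 - w (fst p)) *
      indicator {p. 0 \<le> snd p \<and> snd p < w (fst p) - w' (fst p)} p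
      + indicat_real {p. w (fst p) - w' (fst p) \<le> snd p \<and> snd p < 1} p" for p
  have "g \<in> borel_measurable (borel \<Otimes>\<^sub>M borel)"
    unfolding g_def by measurable
  then have "g \<in> borel_measurable (restrict_space borel (strip T))"
    by (simp add: borel_prod measurable_restrict_space1)
  moreover have "f p = g p" if "p \<in> strip T" for p
    using that le[of "fst p"]
    by (auto simp: f_def g_def strip_def w_def w'_def theta0_def split: split_indicator)
  ultimately have "f \<in> borel_measurable (restrict_space borel (strip T))"
    by (subst measurable_cong[where g = g]) (auto simp: space_restrict_space)
  moreover have "0 \<le> f p" if "p \<in> strip T" for p
    using that le[of "fst p"] theta_nonneg
    by (cases p) (auto simp: f_def strip_def split: split_indicator)
  ultimately show ?thesis unfolding f_def[symmetric] by (simp add: nonneg_measurable_def)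
qed

text \<open>At each fixed time the translation by 1 - z s carries [0, z s - z' s) onto [1 - z s, 1 -
  z' s), so the claim is Fubini plus translation invariance of Lebesgue measure. The summand with
  rate 1 is cut away by the indicator in \<open>f\<close>.\<close>

lemma shift_integral:
  assumes z: "continuous_on {0..T} z" "continuous_on {0..T} z'" and t: "t \<in> {0..T}"
    and le: "\<And>s. s \<in> {0..T} \<Longrightarrow> 0 \<le> z' s \<and> z' s \<le> z s \<and> z s \<le> 1"
  defines "f \<equiv> (\<lambda>(s, y). indicator {0..<z s - z' s} y *
    (\<theta> (s, y + 1 - z s) * indicator {0..<z s - z' s} y + indicator {z s - z' s..<1} y))"
  shows "(LINT p:strip t|lborel. f p)
      = (LINT (s, y):strip t|lborel. indicator {1 - z s..<1 - z' s} y * \<theta> (s, y))"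
    and "set_integrable lborel (strip t) f"
proof -
  define k where "k = (\<lambda>(s, y). indicator (strip t) (s, y) * (indicator {1 - z s..<1 - z' s} y * \<theta> (s, y)))"
  define h where "h p = indicator (strip t) p *\<^sub>R f p" for p
  have hk: "h (s, y) = k (s, y + 1 - z s)" for s y
    using le[of s] t by (auto simp: h_def f_def k_def strip_def split: split_indicator)
  have k: "integrable lborel k"
    unfolding k_def by (rule J_diff(2)[OF z t]) (use le in auto)
  have h: "integrable lborel h"
  proof (rule integrable_bounded_on_strip[where C = L])
    define w where "w s = z (max 0 (min T s))" for s
    define w' where "w' s = z' (max 0 (min T s))" for s
    have [measurable]: "w \<in> borel_measurable borel" "w' \<in> borel_measurable borel"
      unfolding w_def w'_def using continuous_on_clamp[OF z(1)] continuous_on_clamp[OF z(2)] T_pos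
      by (auto intro: borel_measurable_continuous_onI)
    have "h p = indicator (strip t) p * (indicator {p. 0 \<le> snd p \<and> snd p < w (fst p) - w' (fst p)} p
        * theta0 (fst p, snd p + 1 - w (fst p)))" for p
      using t le[of "fst p"]
      by (cases p) (auto simp: h_def f_def strip_def w_def w'_def theta0_def split: split_indicator)
    then have "h = (\<lambda>p. indicator (strip t) p * (indicator {p. 0 \<le> snd p \<and> snd p < w (fst p) - w' (fst p)} p
        * theta0 (fst p, snd p + 1 - w (fst p))))" by blast
    also have "\<dots> \<in> borel_measurable (borel \<Otimes>\<^sub>M borel)" by measurable
    finally show "h \<in> borel_measurable borel" by (simp only: borel_prod)
    show "\<bar>h p\<bar> \<le> L * indicator (strip T) p" for p
    proof -
      obtain s y where p: "p = (s, y)" by fastforce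
      show ?thesis
        using t le[of s] L_nonneg theta_nonneg[of "(s, y + 1 - z s)"] theta_le[of "(s, y + 1 - z s)"]
        by (auto simp: p h_def f_def strip_def split: split_indicator)
    qed
  qed
  then show "set_integrable lborel (strip t) f"
    by (simp add: set_integrable_def h_def[abs_def])
  have "(LINT p:strip t|lborel. f p) = (\<integral>s. (\<integral>y. h (s, y) \<partial>lborel) \<partial>lborel)"
    unfolding set_lebesgue_integral_def h_def[symmetric] by (rule integral_pair_real(1)[OF h])
  also have "(\<lambda>s. \<integral>y. h (s, y) \<partial>lborel) = (\<lambda>s. \<integral>y. k (s, y) \<partial>lborel)"
  proof
    fix s
    show "(\<integral>y. h (s, y) \<partial>lborel) = (\<integral>y. k (s, y) \<partial>lborel)"
      using lborel_integral_real_affine[of 1 "\<lambda>y. k (s, y)" "1 - z s"] by (simp add: hk algebra_simps)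
  qed
  also have "(\<integral>s. (\<integral>y. k (s, y) \<partial>lborel) \<partial>lborel) = (\<integral>p. k p \<partial>lborel)"
    by (rule integral_pair_real(1)[OF k, symmetric])
  also have "\<dots> = (LINT (s, y):strip t|lborel. indicator {1 - z s..<1 - z' s} y * \<theta> (s, y))"
    unfolding set_lebesgue_integral_def k_def
    by (intro Bochner_Integration.integral_cong) auto
  finally show "(LINT p:strip t|lborel. f p)
      = (LINT (s, y):strip t|lborel. indicator {1 - z s..<1 - z' s} y * \<theta> (s, y))" .
qed

end

section \<open>Arrivals and absolute continuity\<close>

text \<open>The tangent to \<open>ell\<close> at \<open>exp 1\<close> has slope 1, so a finite
  integral of \<open>ell\<close> controls that of the function itself on a set of finite measure. In
  the proof this is ln w \<le> w - 1 at w = exp 1 / z.\<close>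

lemma ell_ge: "0 \<le> z \<Longrightarrow> z \<le> ell z + exp 1"
proof (cases "z = 0")
  case False
  assume "0 \<le> z"
  with False have z: "0 < z" by simp
  have "ln (exp 1 / z) \<le> exp 1 / z - 1" using z by (intro ln_le_minus_one) simp
  then have "2 - ln z \<le> exp 1 / z" using z by (simp add: ln_div)
  then have "z * (2 - ln z) \<le> exp 1" using z by (simp add: field_simps)
  then show ?thesis by (simp add: ell_def algebra_simps)
qed (simp add: ell_def)

lemma control_integrable:
  assumes \<alpha>: "\<alpha> \<in> nonneg_measurable T"
    and fin: "(\<integral>\<^sup>+p\<in>strip T. ennreal (ell (\<alpha> p)) \<partial>lborel) < \<infinity>"
  shows "set_integrable lborel (strip T) \<alpha>"
  unfolding set_integrable_def
proof (rule integrableI_bounded)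
  have m: "(\<lambda>p. indicator (strip T) p *\<^sub>R \<alpha> p) \<in> borel_measurable borel"
    using \<alpha> by (subst borel_measurable_restrict_space_iff[symmetric]) (auto simp: nonneg_measurable_def)
  then show "(\<lambda>p. indicator (strip T) p *\<^sub>R \<alpha> p) \<in> borel_measurable lborel" by simp
  have "(\<lambda>p. indicator (strip T) p * \<alpha> p) \<in> borel_measurable borel" using m by simp
  then have m2: "(\<lambda>p. ell (indicator (strip T) p * \<alpha> p)) \<in> borel_measurable borel"
    unfolding ell_def by measurable
  have "(\<integral>\<^sup>+p. ennreal (norm (indicator (strip T) p *\<^sub>R \<alpha> p)) \<partial>lborel)
      \<le> (\<integral>\<^sup>+p. ennreal (ell (indicator (strip T) p * \<alpha> p)) * indicator (strip T) p
          + ennreal (exp 1) * indicator (strip T) p \<partial>lborel)"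
  proof (rule nn_integral_mono)
    fix p
    show "ennreal (norm (indicator (strip T) p *\<^sub>R \<alpha> p))
      \<le> ennreal (ell (indicator (strip T) p * \<alpha> p)) * indicator (strip T) p + ennreal (exp 1) * indicator (strip T) p"
    proof (cases "p \<in> strip T")
      case True
      then have "0 \<le> \<alpha> p" using \<alpha> by (simp add: nonneg_measurable_def)
      then have "ennreal (\<alpha> p) \<le> ennreal (ell (\<alpha> p)) + ennreal (exp 1)"
      \<comment> \<open>\<open>ennreal\<close> truncates at 0, so where \<open>ell\<close> is
        negative the first summand is void, and \<open>ell_ge\<close> leaves the bound
        \<open>exp 1\<close>.\<close>
      proof (cases "0 \<le> ell (\<alpha> p)")
        case True
        then show ?thesis
          using ell_ge[OF \<open>0 \<le> \<alpha> p\<close>] by (simp flip: ennreal_plus)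
      next
        case False
        then have "\<alpha> p \<le> exp 1" using ell_ge[OF \<open>0 \<le> \<alpha> p\<close>] by simp
        then show ?thesis using False by (simp add: ennreal_neg ennreal_leI)
      qed
      then show ?thesis using True \<open>0 \<le> \<alpha> p\<close> by simp
    qed simp
  qed
  also have "\<dots> = (\<integral>\<^sup>+p\<in>strip T. ennreal (ell (indicator (strip T) p * \<alpha> p)) \<partial>lborel)
      + ennreal (exp 1) * emeasure lborel (strip T)"
    using m2 by (subst nn_integral_add) (auto simp: nn_integral_cmult_indicator)
  also have "(\<integral>\<^sup>+p\<in>strip T. ennreal (ell (indicator (strip T) p * \<alpha> p)) \<partial>lborel)
      = (\<integral>\<^sup>+p\<in>strip T. ennreal (ell (\<alpha> p)) \<partial>lborel)"
    by (intro nn_integral_cong) (auto split: split_indicator)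
  also have "\<dots> + ennreal (exp 1) * emeasure lborel (strip T) < \<infinity>"
    using fin emeasure_strip[of T] by (simp add: ennreal_mult_less_top)
  finally show "(\<integral>\<^sup>+p. ennreal (norm (indicator (strip T) p *\<^sub>R \<alpha> p)) \<partial>lborel) < \<infinity>" .
qed

text \<open>Absolute continuity is stated with disjoint open intervals, whereas increments of the
  integral live on (u, v]. If a point lay in two of the latter, points just to its left would lie in
  both open intervals.\<close>

lemma sum_disjoint_Ioc_le:
  fixes D :: "(real \<times> real) set"
  assumes "finite D" and "\<And>u v. (u, v) \<in> D \<Longrightarrow> u \<le> v"
    and dis: "pairwise (\<lambda>p q. {fst p<..<snd p} \<inter> {fst q<..<snd q} = {}) D"
  shows "(\<Sum>(u, v)\<in>D. indicator {u<..v} s) \<le> (1 :: real)"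
proof (cases "\<exists>(u, v)\<in>D. s \<in> {u<..v}")
  case True
  then obtain u v where uv: "(u, v) \<in> D" "u < s" "s \<le> v" by auto
  have "indicator {u'<..v'} s = (0::real)" if "(u', v') \<in> D" "(u', v') \<noteq> (u, v)" for u' v'
  proof (rule ccontr)
    assume "indicator {u'<..v'} s \<noteq> (0::real)"
    then have s: "u' < s" "s \<le> v'" by (auto simp: indicator_def split: if_splits)
    obtain r where "max u u' < r" "r < s" using dense[of "max u u'" s] uv s by auto
    then have "r \<in> {u<..<v} \<inter> {u'<..<v'}" using uv s by auto
    then show False using dis that uv unfolding pairwise_def by (metis empty_iff fst_conv snd_conv)
  qed
  then have "(\<Sum>(u, v)\<in>D. indicator {u<..v} s) = (\<Sum>(u, v)\<in>{(u, v)}. indicator {u<..v} s :: real)"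
    using assms(1) uv by (intro sum.mono_neutral_right) auto
  then show ?thesis by (simp split: split_indicator)
next
  case False
  then have "(\<Sum>(u, v)\<in>D. indicator {u<..v} s) = (0::real)"
    by (intro sum.neutral) (auto split: split_indicator)
  then show ?thesis by simp
qed

locale arrivals =
  fixes T :: real and \<alpha> :: "real \<times> real \<Rightarrow> real"
  assumes T_pos: "0 < T" and alpha_nonneg: "\<And>p. p \<in> strip T \<Longrightarrow> 0 \<le> \<alpha> p"
    and alpha_integrable: "set_integrable lborel (strip T) \<alpha>"
begin

definition a :: "real \<Rightarrow> real" where
  "a t = (LINT p:strip t|lborel. \<alpha> p)"

lemma a_zero: "a 0 = 0"
  unfolding a_def by (rule strip_integral_0)

lemma a_int: "t \<in> {0..T} \<Longrightarrow> set_integrable lborel (strip t) \<alpha>"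
  by (rule set_integrable_subset[OF alpha_integrable]) (use strip_mono in auto)

lemma a_increment:
  assumes uv: "0 \<le> u" "u \<le> v" "v \<le> T"
  shows "a v - a u = (\<integral>p. indicator {u<..v} (fst p) * (indicator (strip T) p * \<alpha> p) \<partial>lborel)"
    and "integrable lborel (\<lambda>p. indicator {u<..v} (fst p) * (indicator (strip T) p * \<alpha> p))"
proof -
  have eq: "(\<lambda>p. indicator {u<..v} (fst p) * (indicator (strip T) p * \<alpha> p))
      = (\<lambda>p. indicator (strip v) p *\<^sub>R \<alpha> p - indicator (strip u) p *\<^sub>R \<alpha> p)"
    using uv by (auto simp: fun_eq_iff strip_def split: split_indicator)
  have i: "integrable lborel (\<lambda>p. indicator (strip v) p *\<^sub>R \<alpha> p)" "integrable lborel (\<lambda>p. indicator (strip u) p *\<^sub>R \<alpha> p)"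
    using a_int[of u] a_int[of v] uv by (auto simp: set_integrable_def)
  then show "integrable lborel (\<lambda>p. indicator {u<..v} (fst p) * (indicator (strip T) p * \<alpha> p))"
    unfolding eq by simp
  show "a v - a u = (\<integral>p. indicator {u<..v} (fst p) * (indicator (strip T) p * \<alpha> p) \<partial>lborel)"
    unfolding eq a_def set_lebesgue_integral_def
    by (rule Bochner_Integration.integral_diff[OF i, symmetric])
qed

lemma a_mono: "0 \<le> u \<Longrightarrow> u \<le> v \<Longrightarrow> v \<le> T \<Longrightarrow> a u \<le> a v"
proof -
  assume uv: "0 \<le> u" "u \<le> v" "v \<le> T"
  have "0 \<le> (\<integral>p. indicator {u<..v} (fst p) * (indicator (strip T) p * \<alpha> p) \<partial>lborel)"
    using alpha_nonneg by (intro Bochner_Integration.integral_nonneg) (auto split: split_indicator)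
  then show ?thesis using a_increment(1)[OF uv] by simp
qed

text \<open>Absolute continuity of the integral: \<alpha> is cut off at a high level n, where the excess has
  small integral, while the bounded part is Lipschitz.\<close>

lemma a_abs_continuous: "abs_continuous_on 0 T a"
  unfolding abs_continuous_on_def
proof (intro allI impI)
  fix e :: real assume e: "e > 0"
  define f where "f p = indicator (strip T) p * \<alpha> p" for p
  have f: "integrable lborel f" using alpha_integrable by (simp add: set_integrable_def f_def[abs_def])
  have f0: "0 \<le> f p" for p using alpha_nonneg by (simp add: f_def split: split_indicator)
  define h where "h n p = f p - min (f p) (real n)" for n p
  have hm: "h n \<in> borel_measurable lborel" for n
    unfolding h_def using f by measurable
  have "(\<lambda>n. \<integral>p. h n p \<partial>lborel) \<longlonglongrightarrow> (\<integral>p. 0 \<partial>(lborel :: (real \<times> real) measure))"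
  proof (rule integral_dominated_convergence[where w = f])
    show "AE p in lborel. (\<lambda>n. h n p) \<longlonglongrightarrow> 0"
    proof (rule AE_I2, rule tendsto_eventually)
      fix p
      obtain N :: nat where "f p \<le> real N" using real_arch_simple by blast
      then show "\<forall>\<^sub>F n in sequentially. h n p = 0"
        by (intro eventually_sequentiallyI[of N]) (auto simp: h_def min_def)
    qed
    show "AE p in lborel. norm (h n p) \<le> f p" for n
      using f0 by (auto simp: h_def min_def)
  qed (use f hm in auto)
  then have "(\<lambda>n. \<integral>p. h n p \<partial>lborel) \<longlonglongrightarrow> 0" by simp
  then have "\<forall>\<^sub>F n in sequentially. (\<integral>p. h n p \<partial>lborel) < e / 2"
    using e by (intro order_tendstoD) auto
  then obtain n where n: "(\<integral>p. h n p \<partial>lborel) < e / 2" by (auto simp: eventually_sequentially)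
  have hi: "integrable lborel (h n)"
    by (rule Bochner_Integration.integrable_bound[OF f])
      (use hm[of n] f0 in \<open>auto simp: h_def min_def\<close>)
  show "\<exists>\<delta>>0. \<forall>D. finite D \<and> (\<forall>(u, v)\<in>D. 0 \<le> u \<and> u \<le> v \<and> v \<le> T) \<and>
        pairwise (\<lambda>p q. {fst p<..<snd p} \<inter> {fst q<..<snd q} = {}) D \<and> (\<Sum>(u, v)\<in>D. v - u) < \<delta>
        \<longrightarrow> (\<Sum>(u, v)\<in>D. \<bar>a v - a u\<bar>) < e"
  \<comment> \<open>The part of the integral above level n is below e / 2 for every D; the rest is
    at most n times the total length. The summand 1 guards against n = 0.\<close>
  proof (intro exI[of _ "e / (2 * (real n + 1))"] conjI allI impI)
    fix D :: "(real \<times> real) set"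
    assume D: "finite D \<and> (\<forall>(u, v)\<in>D. 0 \<le> u \<and> u \<le> v \<and> v \<le> T) \<and>
        pairwise (\<lambda>p q. {fst p<..<snd p} \<inter> {fst q<..<snd q} = {}) D \<and> (\<Sum>(u, v)\<in>D. v - u) < e / (2 * (real n + 1))"
    define I where "I = (\<lambda>(u, v) p. indicator {u<..v} (fst p) * indicator (strip T) (p :: real \<times> real) :: real)"
    have uvD: "0 \<le> u" "u \<le> v" "v \<le> T" if "(u, v) \<in> D" for u v using D that by auto
    have If: "integrable lborel (\<lambda>p. I d p * f p)" if "d \<in> D" for d
    proof -
      obtain u v where d: "d = (u, v)" by fastforce
      have "(\<lambda>p. I d p * f p) = (\<lambda>p. indicator {u<..v} (fst p) * (indicator (strip T) p * \<alpha> p))"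
        by (auto simp: I_def f_def d split: split_indicator)
      then show ?thesis using a_increment(2) uvD that by (simp add: d)
    qed
    have II: "integrable lborel (I d)" and Iint: "(\<integral>p. I d p \<partial>lborel) = snd d - fst d" if "d \<in> D" for d
    proof -
      obtain u v where d: "d = (u, v)" by fastforce
      have I: "I d = (\<lambda>p. indicator (strip v) p - indicator (strip u) p)"
        using uvD[of u v] that by (auto simp: I_def d fun_eq_iff strip_def split: split_indicator)
      show "integrable lborel (I d)" unfolding I using integrable_strip by auto
      show "(\<integral>p. I d p \<partial>lborel) = snd d - fst d"
        unfolding I using uvD[of u v] that by (simp add: integrable_strip measure_strip d)
    qed
    have "(\<Sum>(u, v)\<in>D. \<bar>a v - a u\<bar>) = (\<Sum>d\<in>D. \<integral>p. I d p * f p \<partial>lborel)"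
    proof (rule sum.cong)
      fix d assume d: "d \<in> D"
      obtain u v where uv: "d = (u, v)" by fastforce
      have "\<bar>a v - a u\<bar> = a v - a u" using a_mono uvD d by (simp add: uv)
      also have "\<dots> = (\<integral>p. I d p * f p \<partial>lborel)"
        using a_increment(1)[of u v] uvD[of u v] d
        by (auto simp: uv I_def f_def intro!: Bochner_Integration.integral_cong split: split_indicator)
      finally show "(case d of (u, v) \<Rightarrow> \<bar>a v - a u\<bar>) = (\<integral>p. I d p * f p \<partial>lborel)" by (simp add: uv)
    qed simp
    also have "\<dots> = (\<integral>p. (\<Sum>d\<in>D. I d p * f p) \<partial>lborel)"
      using If by (intro Bochner_Integration.integral_sum[symmetric]) auto
    also have "\<dots> \<le> (\<integral>p. h n p + (\<Sum>d\<in>D. I d p * real n) \<partial>lborel)"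
    proof (rule integral_mono)
      show "(\<Sum>d\<in>D. I d p * f p) \<le> h n p + (\<Sum>d\<in>D. I d p * real n)" for p
      proof -
        have I1: "(\<Sum>d\<in>D. I d p) \<le> 1"
        proof (cases "p \<in> strip T")
          case True
          then have "(\<Sum>d\<in>D. I d p) = (\<Sum>(u, v)\<in>D. indicator {u<..v} (fst p))"
            by (intro sum.cong) (auto simp: I_def)
          then show ?thesis using sum_disjoint_Ioc_le[of D "fst p"] D by auto
        next
          case False
          then have "(\<Sum>d\<in>D. I d p) = 0" by (intro sum.neutral) (auto simp: I_def)
          then show ?thesis by simp
        qed
        have I0: "0 \<le> (\<Sum>d\<in>D. I d p)" by (intro sum_nonneg) (auto simp: I_def)
        have "(\<Sum>d\<in>D. I d p) * f p \<le> h n p + (\<Sum>d\<in>D. I d p) * real n"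
        proof (cases "f p \<le> real n")
          case True
          then show ?thesis using I0 by (simp add: h_def mult_left_mono)
        next
          case False
          then have "(\<Sum>d\<in>D. I d p) * (f p - real n) \<le> 1 * (f p - real n)"
            using I1 by (intro mult_right_mono) auto
          then show ?thesis using False by (simp add: h_def algebra_simps)
        qed
        then show ?thesis by (simp add: sum_distrib_right)
      qed
    qed (use If II hi in auto)
    also have "\<dots> = (\<integral>p. h n p \<partial>lborel) + (\<Sum>(u, v)\<in>D. v - u) * real n"
      using hi II Iint by (subst Bochner_Integration.integral_add)
        (auto simp: Bochner_Integration.integral_sum sum_distrib_right split_beta)
    also have "\<dots> < e / 2 + e / 2"
    proof (rule add_less_le_mono[OF n])
      have "0 \<le> (\<Sum>(u, v)\<in>D. v - u)" using uvD by (intro sum_nonneg) auto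
      then have "(\<Sum>(u, v)\<in>D. v - u) * real n \<le> (\<Sum>(u, v)\<in>D. v - u) * (real n + 1)"
        by (intro mult_left_mono) auto
      also have "\<dots> \<le> e / (2 * (real n + 1)) * (real n + 1)"
        using D by (intro mult_right_mono) auto
      also have "\<dots> = e / 2" by (simp add: field_simps)
      finally show "(\<Sum>(u, v)\<in>D. v - u) * real n \<le> e / 2" .
    qed
    finally show "(\<Sum>(u, v)\<in>D. \<bar>a v - a u\<bar>) < e" by simp
  qed (use e in simp)
qed

end

lemma abs_continuous_dominated:
  assumes a: "abs_continuous_on 0 T a" and cd: "0 \<le> c" "0 \<le> d"
    and f: "\<And>u v. 0 \<le> u \<Longrightarrow> u \<le> v \<Longrightarrow> v \<le> T \<Longrightarrow> \<bar>f v - f u\<bar> \<le> c * (a v - a u) + d * (v - u)"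
  shows "abs_continuous_on 0 T f"
  unfolding abs_continuous_on_def
proof (intro allI impI)
  fix e :: real assume e: "e > 0"
  \<comment> \<open>Dividing by c + 1, and later by d + 1, covers the cases c = 0 and d = 0.\<close>
  have "0 < e / (2 * (c + 1))" using e cd by simp
  then obtain \<delta> where \<delta>: "\<delta> > 0" and a\<delta>: "\<And>D. finite D \<Longrightarrow> (\<forall>(u, v)\<in>D. 0 \<le> u \<and> u \<le> v \<and> v \<le> T) \<Longrightarrow>
        pairwise (\<lambda>p q. {fst p<..<snd p} \<inter> {fst q<..<snd q} = {}) D \<Longrightarrow> (\<Sum>(u, v)\<in>D. v - u) < \<delta>
        \<Longrightarrow> (\<Sum>(u, v)\<in>D. \<bar>a v - a u\<bar>) < e / (2 * (c + 1))"
    using a unfolding abs_continuous_on_def by meson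
  show "\<exists>\<delta>>0. \<forall>D. finite D \<and> (\<forall>(u, v)\<in>D. 0 \<le> u \<and> u \<le> v \<and> v \<le> T) \<and>
        pairwise (\<lambda>p q. {fst p<..<snd p} \<inter> {fst q<..<snd q} = {}) D \<and> (\<Sum>(u, v)\<in>D. v - u) < \<delta>
        \<longrightarrow> (\<Sum>(u, v)\<in>D. \<bar>f v - f u\<bar>) < e"
  proof (intro exI[of _ "min \<delta> (e / (2 * (d + 1)))"] conjI allI impI)
    fix D :: "(real \<times> real) set"
    assume D: "finite D \<and> (\<forall>(u, v)\<in>D. 0 \<le> u \<and> u \<le> v \<and> v \<le> T) \<and>
        pairwise (\<lambda>p q. {fst p<..<snd p} \<inter> {fst q<..<snd q} = {}) D \<and>
        (\<Sum>(u, v)\<in>D. v - u) < min \<delta> (e / (2 * (d + 1)))"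
    define X where "X = (\<Sum>(u, v)\<in>D. \<bar>a v - a u\<bar>)"
    define Y where "Y = (\<Sum>(u, v)\<in>D. v - u)"
    have X: "X < e / (2 * (c + 1))" unfolding X_def by (rule a\<delta>) (use D in auto)
    have Y: "Y < e / (2 * (d + 1))" using D by (simp add: Y_def)
    have X0: "0 \<le> X" unfolding X_def by (intro sum_nonneg) auto
    have Y0: "0 \<le> Y" unfolding Y_def using D by (intro sum_nonneg) auto
    have "(\<Sum>(u, v)\<in>D. \<bar>f v - f u\<bar>) \<le> (\<Sum>(u, v)\<in>D. c * \<bar>a v - a u\<bar> + d * (v - u))"
    proof (rule sum_mono, clarify)
      fix u v assume "(u, v) \<in> D"
      then have "\<bar>f v - f u\<bar> \<le> c * (a v - a u) + d * (v - u)" using D f by auto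
      also have "\<dots> \<le> c * \<bar>a v - a u\<bar> + d * (v - u)" using cd by (simp add: mult_left_mono)
      finally show "\<bar>f v - f u\<bar> \<le> c * \<bar>a v - a u\<bar> + d * (v - u)" .
    qed
    also have "\<dots> = c * X + d * Y"
      by (simp add: X_def Y_def sum_distrib_left sum.distrib split_beta)
    also have "c * X \<le> (c + 1) * X" using X0 by (simp add: algebra_simps)
    also have "d * Y \<le> (d + 1) * Y" using Y0 by (simp add: algebra_simps)
    also have "(c + 1) * X + (d + 1) * Y < e / 2 + e / 2"
      using X Y cd by (intro add_strict_mono) (simp_all add: field_simps)
    finally show "(\<Sum>(u, v)\<in>D. \<bar>f v - f u\<bar>) < e" by simp
  qed (use \<delta> e cd in auto)
qed

lemma abs_continuous_on_imp_continuous_on: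
  assumes "abs_continuous_on 0 T f"
  shows "continuous_on {0..T} f"
  unfolding continuous_on_iff
proof (intro ballI allI impI)
  fix t e :: real assume t: "t \<in> {0..T}" and e: "e > 0"
  obtain \<delta> where \<delta>: "\<delta> > 0" and fd: "\<And>D. finite D \<Longrightarrow> (\<forall>(u, v)\<in>D. 0 \<le> u \<and> u \<le> v \<and> v \<le> T) \<Longrightarrow>
        pairwise (\<lambda>p q. {fst p<..<snd p} \<inter> {fst q<..<snd q} = {}) D \<Longrightarrow> (\<Sum>(u, v)\<in>D. v - u) < \<delta>
        \<Longrightarrow> (\<Sum>(u, v)\<in>D. \<bar>f v - f u\<bar>) < e"
    using assms e unfolding abs_continuous_on_def by meson
  show "\<exists>d>0. \<forall>s\<in>{0..T}. dist s t < d \<longrightarrow> dist (f s) (f t) < e"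
  proof (intro exI[of _ \<delta>] conjI ballI impI)
    fix s assume s: "s \<in> {0..T}" "dist s t < \<delta>"
    then show "dist (f s) (f t) < e"
      using fd[of "{(s, t)}"] fd[of "{(t, s)}"] t
      by (cases "s \<le> t") (auto simp: dist_real_def abs_minus_commute)
  qed (rule \<delta>)
qed

section \<open>Stieltjes measures\<close>

lemma stieltjes_Ioc:
  fixes g :: "real \<Rightarrow> real"
  assumes T: "0 \<le> T" and mono: "mono_on {0..T} g" and cont: "continuous_on {0..T} g" and ab: "a \<le> b"
  shows "emeasure (stieltjes T g) {a<..b} = ennreal (g (max 0 (min T b)) - g (max 0 (min T a)))"
  unfolding stieltjes_def
proof (rule emeasure_interval_measure_Ioc[OF ab])
  show "g (max 0 (min T x)) \<le> g (max 0 (min T y))" if "x \<le> y" for x y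
    using mono that T by (auto simp: mono_on_def)
  show "continuous (at_right x) (\<lambda>s. g (max 0 (min T s)))" for x
    using continuous_on_clamp[OF cont T]
    by (simp add: continuous_on_eq_continuous_within continuous_at_imp_continuous_at_within)
qed

lemma sets_stieltjes [simp, measurable_cong]: "sets (stieltjes T g) = sets borel"
  by (simp add: stieltjes_def)

text \<open>Every point of [0, T] with h < 1 lies in an interval (p, q] with rational endpoints and
  no mass. There are countably many of these, so the integrand vanishes almost everywhere.\<close>

lemma stieltjes_integral_0I:
  fixes g h :: "real \<Rightarrow> real"
  assumes T: "0 \<le> T" and mono: "mono_on {0..T} g" and cont: "continuous_on {0..T} g"
    and h: "continuous_on {0..T} h" "\<And>s. s \<in> {0..T} \<Longrightarrow> h s \<le> 1"
    and flat: "\<And>a b. 0 \<le> a \<Longrightarrow> a \<le> b \<Longrightarrow> b \<le> T \<Longrightarrow> (\<And>s. a \<le> s \<Longrightarrow> s \<le> b \<Longrightarrow> h s < 1) \<Longrightarrow> g a = g b"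
  shows "(LINT s:{0..T}|stieltjes T g. 1 - h s) = 0"
proof -
  \<comment> \<open>Rational endpoints around 0 or T may leave [0, T], where nothing is known of g;
    the clamped \<open>G\<close> is constant there.\<close>
  define G where "G s = g (max 0 (min T s))" for s
  define I where "I = {(p, q) \<in> \<rat> \<times> \<rat>. p \<le> q \<and> G p = G q}"
  have "countable I"
    unfolding I_def by (rule countable_subset[of _ "\<rat> \<times> \<rat>"]) (auto simp: countable_rat)
  moreover have "{p<..q} \<in> null_sets (stieltjes T g)" if "(p, q) \<in> I" for p q
    using that stieltjes_Ioc[OF T mono cont, of p q] by (auto simp: I_def G_def)
  ultimately have "(\<Union>(p, q)\<in>I. {p<..q}) \<in> null_sets (stieltjes T g)"
    by (intro null_sets_UN') auto
  then have "AE s in stieltjes T g. s \<notin> (\<Union>(p, q)\<in>I. {p<..q})" by (rule AE_not_in)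
  then have "AE s in stieltjes T g. indicator {0..T} s *\<^sub>R (1 - h s) = 0"
  proof (rule AE_mp, intro AE_I2 impI)
    fix s assume s: "s \<notin> (\<Union>(p, q)\<in>I. {p<..q})"
    show "indicator {0..T} s *\<^sub>R (1 - h s) = 0"
    proof (rule ccontr)
      assume "indicator {0..T} s *\<^sub>R (1 - h s) \<noteq> 0"
      then have sT: "s \<in> {0..T}" and hs: "h s < 1"
        using h(2)[of s] by (auto simp: indicator_def split: if_splits)
      obtain d where d: "d > 0" "\<And>r. r \<in> {0..T} \<Longrightarrow> \<bar>r - s\<bar> < d \<Longrightarrow> \<bar>h r - h s\<bar> < 1 - h s"
        using h(1) sT hs unfolding continuous_on_iff dist_real_def by (metis diff_gt_0_iff_gt)
      obtain p where p: "p \<in> \<rat>" "s - d < p" "p < s" using Rats_dense_in_real[of "s - d" s] d by auto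
      obtain q where q: "q \<in> \<rat>" "s < q" "q < s + d" using Rats_dense_in_real[of s "s + d"] d by auto
      have "G p = G q"
        unfolding G_def
      proof (rule flat)
        fix r assume "max 0 (min T p) \<le> r" "r \<le> max 0 (min T q)"
        then have "r \<in> {0..T}" "\<bar>r - s\<bar> < d" using p q sT T by (auto simp: min_def max_def split: if_splits)
        from d(2)[OF this] show "h r < 1" by linarith
      qed (use p q T in auto)
      then have "(p, q) \<in> I" using p q by (auto simp: I_def)
      then show False using s p q by force
    qed
  qed
  then show ?thesis unfolding set_lebesgue_integral_def by (rule integral_eq_zero_AE)
qed

text \<open>A nonnegative integrable function with integral 0 vanishes almost everywhere, so (a, b]
  is null. Integrability has to be verified first, since the Bochner integral of a non-integrable
  function is 0 as well.\<close>

lemma stieltjes_integral_0D: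
  fixes g h :: "real \<Rightarrow> real"
  assumes T: "0 \<le> T" and mono: "mono_on {0..T} g" and cont: "continuous_on {0..T} g"
    and h: "continuous_on {0..T} h" "\<And>s. s \<in> {0..T} \<Longrightarrow> h s \<in> {0..1}"
    and int0: "(LINT s:{0..T}|stieltjes T g. 1 - h s) = 0"
    and ab: "0 \<le> a" "a \<le> b" "b \<le> T" and less: "\<And>s. a \<le> s \<Longrightarrow> s \<le> b \<Longrightarrow> h s < 1"
  shows "g a = g b"
proof -
  define k where "k s = indicator {0..T} s *\<^sub>R (1 - h s)" for s
  have km: "k \<in> borel_measurable borel"
    unfolding k_def using h(1) by (intro borel_measurable_continuous_on_indicator continuous_intros) auto
  \<comment> \<open>The left end -1 makes the half-open interval contain 0; its mass is still g T -
    g 0.\<close>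
  have k0: "0 \<le> k s" "k s \<le> indicator {-1<..T} s" for s
    using h(2)[of s] by (auto simp: k_def split: split_indicator)
  have "integrable (stieltjes T g) k"
  proof (rule Bochner_Integration.integrable_bound)
    show "integrable (stieltjes T g) (indicator {-1<..T} :: _ \<Rightarrow> real)"
      using stieltjes_Ioc[OF T mono cont, of "-1" T] T by (intro integrable_real_indicator) auto
    show "AE s in stieltjes T g. norm (k s) \<le> norm (indicator {-1<..T} s :: real)"
      using k0 by auto
  qed (use km in \<open>simp add: measurable_def\<close>)
  moreover have "(\<integral>s. k s \<partial>stieltjes T g) = 0"
    using int0 by (simp add: set_lebesgue_integral_def k_def)
  ultimately have "AE s in stieltjes T g. k s = 0"
    using integral_nonneg_eq_0_iff_AE[of "stieltjes T g" k] k0 by auto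
  then have "AE s in stieltjes T g. s \<notin> {a<..b}"
  proof (rule AE_mp, intro AE_I2 impI notI)
    fix s assume "k s = 0" "s \<in> {a<..b}"
    then show False using less[of s] ab by (auto simp: k_def)
  qed
  then have "{a<..b} \<in> null_sets (stieltjes T g)"
    by (subst AE_iff_null_sets) (simp_all add: stieltjes_def)
  then have "ennreal (g b - g a) = 0"
    using stieltjes_Ioc[OF T mono cont ab(2)] ab by (simp add: null_sets_def)
  moreover have "g a \<le> g b" using mono ab by (auto simp: mono_on_def)
  ultimately show ?thesis by (simp add: ennreal_eq_0_iff)
qed

section \<open>Existence and uniqueness\<close>

text \<open>Uniformly small tails reduce convergence in norm to that of finitely many coordinates.
  The tail condition speaks of finite sums, so that summability comes out as a conclusion.\<close>

lemma continuous_ell1I: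
  fixes f :: "real \<Rightarrow> nat \<Rightarrow> real"
  assumes cont: "\<And>i. i \<ge> 1 \<Longrightarrow> continuous_on I (\<lambda>t. f t i)"
    and tail: "\<And>e. e > 0 \<Longrightarrow> \<exists>N. \<forall>t\<in>I. \<forall>m. (\<Sum>j=Suc N..m. \<bar>f t j\<bar>) \<le> e"
  shows "continuous_ell1 I f"
  unfolding continuous_ell1_def
proof (intro ballI conjI)
  have partial: "(\<Sum>k<n. g (Suc k)) \<le> (\<Sum>j=1..N. g j) + (\<Sum>j=Suc N..n. g j)"
    if "\<And>j. 0 \<le> g j" for g :: "nat \<Rightarrow> real" and N n
  proof (cases "N \<le> n")
    case True
    then show ?thesis using sum.ub_add_nat[of 1 N g "n - N"] by (simp add: sum.atLeast1_atMost_eq)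
  next
    case False
    have "(\<Sum>j=1..n. g j) \<le> (\<Sum>j=1..N. g j)"
      using False that by (intro sum_mono2) auto
    then show ?thesis using False by (simp add: sum.atLeast1_atMost_eq)
  qed
  fix t assume t: "t \<in> I"
  obtain N where N: "\<And>m. (\<Sum>j=Suc N..m. \<bar>f t j\<bar>) \<le> 1" using tail[of 1] t by auto
  have "(\<Sum>k<n. \<bar>f t (Suc k)\<bar>) \<le> (\<Sum>j=1..N. \<bar>f t j\<bar>) + 1" for n
    using partial[of "\<lambda>j. \<bar>f t j\<bar>" n N] N[of n] by simp
  then show "f t \<in> ell1"
    unfolding ell1_def by (auto intro!: summableI_nonneg_bounded)
  show "((\<lambda>s. norm1 (\<lambda>i. f s i - f t i)) \<longlongrightarrow> 0) (at t within I)"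
  proof (rule tendstoI)
    fix e :: real assume e: "e > 0"
    \<comment> \<open>The head and each of the two tails take e / 4; the remaining quarter keeps the
      final inequality strict after passing to the infinite sum.\<close>
    then obtain N where N: "\<And>s m. s \<in> I \<Longrightarrow> (\<Sum>j=Suc N..m. \<bar>f s j\<bar>) \<le> e / 4"
      using tail[of "e / 4"] by auto
    have "((\<lambda>s. \<Sum>j=1..N. \<bar>f s j - f t j\<bar>) \<longlongrightarrow> (\<Sum>j=1..N. \<bar>f t j - f t j\<bar>)) (at t within I)"
      using cont t by (intro tendsto_intros) (auto simp: continuous_on_def)
    then have "\<forall>\<^sub>F s in at t within I. (\<Sum>j=1..N. \<bar>f s j - f t j\<bar>) < e / 4"
      using e by (intro order_tendstoD) auto
    moreover have "\<forall>\<^sub>F s in at t within I. s \<in> I" by (simp add: eventually_at_filter)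
    ultimately show "\<forall>\<^sub>F s in at t within I. dist (norm1 (\<lambda>i. f s i - f t i)) 0 < e"
    proof eventually_elim
      case (elim s)
      have "(\<Sum>j=Suc N..n. \<bar>f s j - f t j\<bar>) \<le> e / 2" for n
      proof -
        have "(\<Sum>j=Suc N..n. \<bar>f s j - f t j\<bar>) \<le> (\<Sum>j=Suc N..n. \<bar>f s j\<bar> + \<bar>f t j\<bar>)"
          by (intro sum_mono abs_triangle_ineq4)
        then show ?thesis using N[OF elim(2), of n] N[OF t, of n] by (simp add: sum.distrib)
      qed
      then have bnd: "(\<Sum>k<n. \<bar>f s (Suc k) - f t (Suc k)\<bar>) \<le> e / 4 + e / 2" for n
        using partial[of "\<lambda>j. \<bar>f s j - f t j\<bar>" n N] elim(1) by (smt (verit) abs_ge_zero)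
      have "summable (\<lambda>k. \<bar>f s (Suc k) - f t (Suc k)\<bar>)"
        by (rule summableI_nonneg_bounded[OF _ bnd]) simp
      then have "norm1 (\<lambda>i. f s i - f t i) \<le> e / 4 + e / 2" "0 \<le> norm1 (\<lambda>i. f s i - f t i)"
        unfolding norm1_def by (intro suminf_le_const bnd suminf_nonneg; simp)+
      then show ?case using e by simp
    qed
  qed
qed

theorem lemma7p1:
  fixes T lam :: real and x :: "nat \<Rightarrow> real" and \<alpha> \<theta> :: "real \<times> real \<Rightarrow> real"
  assumes "0 < T" and "0 < lam"
    and "x \<in> ell1_down"
    and "\<alpha> \<in> nonneg_measurable T" and "\<theta> \<in> nonneg_measurable T"
    and "(\<integral>\<^sup>+p\<in>strip T. ennreal (ell (\<alpha> p)) \<partial>lborel) < \<infinity>"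
    and "(SUP p\<in>strip T. ereal (\<theta> p)) < \<infinity>"
    and "\<forall>s\<in>{0..T}. AE y in lborel. y \<in> {0..1} \<longrightarrow> continuous (at y within {0..1}) (\<lambda>y. \<theta> (s, y))"
  shows "\<exists>\<zeta> \<psi>.
    (\<zeta>, \<psi>) \<in> paths_C T x \<and> solves T lam x \<alpha> \<theta> \<zeta> \<psi> \<and>
    (\<forall>\<zeta>' \<psi>'. (\<zeta>', \<psi>') \<in> paths_C T x \<and> solves T lam x \<alpha> \<theta> \<zeta>' \<psi>' \<longrightarrow>
       (\<forall>t\<in>{0..T}. \<forall>i\<ge>1. \<zeta>' t i = \<zeta> t i \<and> \<psi>' t i = \<psi> t i)) \<and>
    shifted_control \<alpha> \<theta> \<zeta> \<in> controls_S T lam x \<zeta> \<psi>"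
proof -
  have theta_nonneg: "0 \<le> \<theta> p" if "p \<in> strip T" for p
    using assms(5) that by (simp add: nonneg_measurable_def)
  obtain L where L: "\<And>p. p \<in> strip T \<Longrightarrow> \<theta> p \<le> L"
  proof -
    define B where "B = (SUP p\<in>strip T. ereal (\<theta> p))"
    have le: "ereal (\<theta> p) \<le> B" if "p \<in> strip T" for p
      unfolding B_def using that by (rule SUP_upper)
    have "(0, 0) \<in> strip T" using assms(1) by (simp add: strip_def)
    from le[OF this] theta_nonneg[OF this] have "B \<noteq> -\<infinity>" by auto
    moreover have "B \<noteq> \<infinity>" using assms(7) by (simp add: B_def)
    ultimately obtain b where "B = ereal b" by (cases B) auto
    then show thesis using le by (intro that[of b]) auto
  qed
  interpret S: service T L \<theta>
    by unfold_locales (use assms L in auto)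
  interpret R: arrivals T \<alpha>
    by unfold_locales (use assms control_integrable in \<open>auto simp: nonneg_measurable_def\<close>)
  have a_cont: "continuous_on {0..T} R.a"
    by (rule abs_continuous_on_imp_continuous_on[OF R.a_abs_continuous])
  have x: "0 \<le> x (Suc i)" "x (Suc i) \<le> 1" "x (Suc (Suc i)) \<le> x (Suc i)" for i
    using assms(3) by (auto simp: ell1_down_def)
  have x_summable: "summable (\<lambda>i. x (Suc i))"
    using assms(3) x(1) by (simp add: ell1_down_def ell1_def)
  \<comment> \<open>The arrivals enter as \<open>lam * R.a\<close>, and the bound M is the norm of
    x.\<close>
  interpret D: drift T L S.J "\<lambda>t. lam * R.a t" x "\<Sum>i. x (Suc i)"
  proof unfold_locales
    show "(\<Sum>j=1..i. x j) \<le> (\<Sum>i. x (Suc i))" for i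
      using sum_le_suminf[OF x_summable, of "{..<i}"] x(1) by (simp add: sum.atLeast1_atMost_eq)
    show "lam * R.a u \<le> lam * R.a v" if "0 \<le> u" "u \<le> v" "v \<le> T" for u v
      using R.a_mono[OF that] assms(2) by (simp add: mult_left_mono)
  qed (use assms x S.J_increment S.J_compare in \<open>auto simp: S.L_nonneg S.J_zero R.a_zero intro!: continuous_intros a_cont\<close>)

  \<comment> \<open>Stated for an arbitrary candidate, because uniqueness needs it for the
    competitor.\<close>
  have psi_eq: "\<psi> t i = x i - S.J (\<lambda>s. \<zeta> s i) t + S.J (\<lambda>s. \<zeta> s (Suc i)) t + (if i = 1 then lam * R.a t else 0)"
    if "solves T lam x \<alpha> \<theta> \<zeta> \<psi>" "t \<in> {0..T}" "i \<ge> 1" "\<And>i. i \<ge> 1 \<Longrightarrow> continuous_on {0..T} (\<lambda>t. \<zeta> t i)"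
      "\<And>i t. i \<ge> 1 \<Longrightarrow> t \<in> {0..T} \<Longrightarrow> 0 \<le> \<zeta> t i \<and> \<zeta> t (Suc i) \<le> \<zeta> t i" for \<zeta> \<psi> t i
  proof -
    have J: "(LINT (s, y):strip t|lborel. indicator {1 - \<zeta> s j..<1 - \<zeta> s (Suc j)} y * \<theta> (s, y))
        = S.J (\<lambda>s. \<zeta> s j) t - S.J (\<lambda>s. \<zeta> s (Suc j)) t" if j: "j \<ge> 1" for j
      by (rule S.J_diff(1)) (use that \<open>t \<in> {0..T}\<close> \<open>\<And>i. i \<ge> 1 \<Longrightarrow> continuous_on {0..T} (\<lambda>t. \<zeta> t i)\<close>
        \<open>\<And>i t. i \<ge> 1 \<Longrightarrow> t \<in> {0..T} \<Longrightarrow> 0 \<le> \<zeta> t i \<and> \<zeta> t (Suc i) \<le> \<zeta> t i\<close> in auto)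
    show ?thesis
    proof (cases "i = 1")
      case True
      then show ?thesis
        using that(1,2) J[of 1] by (simp add: solves_def R.a_def numeral_2_eq_2)
    next
      case False
      then show ?thesis
        using that(1-3) J[of i] by (simp add: solves_def)
    qed
  qed

  obtain z e K where r: "D.reflected z e"
    and z: "\<And>i t. i \<ge> 1 \<Longrightarrow> t \<in> {0..T} \<Longrightarrow> 0 \<le> z i t \<and> z i t \<le> 1 \<and> z (Suc i) t \<le> z i t"
    and e: "\<And>i u v. 0 \<le> u \<Longrightarrow> u \<le> v \<Longrightarrow> v \<le> T \<Longrightarrow> 0 \<le> e i v - e i u \<and> e i v - e i u \<le> D.V v - D.V u"
    and eK: "\<And>i t. K \<le> i \<Longrightarrow> t \<in> {0..T} \<Longrightarrow> e i t = 0"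
    and tail: "\<And>N m t. t \<in> {0..T} \<Longrightarrow> K \<le> N \<Longrightarrow> (\<Sum>j=Suc N..m. z j t) \<le> (\<Sum>j=Suc N..m. x j)"
    by (rule D.reflected_exists) blast
  have zc: "continuous_on {0..T} (z i)" if "i \<ge> 1" for i
    using r that by (simp add: D.reflected_def D.continuous_levels_def)
  have z_eq: "z i t = D.level z e i t" if "i \<ge> 1" "t \<in> {0..T}" for i t
    using r that by (simp add: D.reflected_def)
  have e0: "e 0 t = lam * R.a t" if "t \<in> {0..T}" for t
    using r that by (simp add: D.reflected_def D.regulators_def)
  have e_reg: "regulates T (real i) (D.unreflected z i) (e i)" if "i \<ge> 1" for i
    using r that by (simp add: D.reflected_def D.regulators_def)

  \<comment> \<open>Index and time change places, and the zeroth regulator is reset to 0: it was the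
    arrival process, which now appears in \<open>\<psi>\<close> at index 1.\<close>
  define \<zeta> where "\<zeta> t i = z i t" for t i
  define \<psi> where "\<psi> t i = x i - S.J (z i) t + S.J (z (Suc i)) t + (if i = 1 then lam * R.a t else 0)" for t i
  define \<eta> where "\<eta> t i = (if i = 0 then 0 else e i t)" for t :: real and i :: nat

  have \<zeta>_eq: "\<zeta> t i = \<psi> t i + \<eta> t (i - 1) - \<eta> t i" if "i \<ge> 1" "t \<in> {0..T}" for t i
    using z_eq[OF that] e0[OF that(2)] that(1) by (auto simp: \<zeta>_def \<psi>_def \<eta>_def D.level_def)

  have z_ac: "abs_continuous_on 0 T (z i)" if i: "i \<ge> 1" for i
  proof (rule abs_continuous_dominated[OF R.a_abs_continuous])
    fix u v assume uv: "0 \<le> u" "u \<le> v" "v \<le> T"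
    have "z i v - z i u = (S.J (z (Suc i)) v - S.J (z (Suc i)) u) - (S.J (z i) v - S.J (z i) u)
        + (e (i - 1) v - e (i - 1) u) - (e i v - e i u)"
      using z_eq[OF i, of u] z_eq[OF i, of v] uv by (simp add: D.level_def)
    moreover note S.J_increment[OF zc uv, of "Suc i"] S.J_increment[OF zc[OF i] uv]
      e[OF uv, of "i - 1"] e[OF uv, of i]
    ultimately have "\<bar>z i v - z i u\<bar> \<le> L * (v - u) + (D.V v - D.V u)" by (simp add: abs_le_iff)
    \<comment> \<open>The second L comes from the linear part of \<open>D.V\<close>.\<close>
    then show "\<bar>z i v - z i u\<bar> \<le> lam * (R.a v - R.a u) + (2 * L) * (v - u)"
      by (simp add: D.V_def algebra_simps)
  qed (use assms(2) S.L_nonneg in auto)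
  have psi_ac: "abs_continuous_on 0 T (\<lambda>t. \<psi> t i)" if i: "i \<ge> 1" for i
  proof (rule abs_continuous_dominated[OF R.a_abs_continuous])
    fix u v assume uv: "0 \<le> u" "u \<le> v" "v \<le> T"
    have "0 \<le> lam * (R.a v - R.a u)" using R.a_mono[OF uv] assms(2) by simp
    moreover have "\<psi> v i - \<psi> u i = (S.J (z (Suc i)) v - S.J (z (Suc i)) u) - (S.J (z i) v - S.J (z i) u)
        + (if i = 1 then lam * (R.a v - R.a u) else 0)"
      by (simp add: \<psi>_def algebra_simps)
    moreover note S.J_increment[OF zc uv, of "Suc i"] S.J_increment[OF zc[OF i] uv]
    ultimately show "\<bar>\<psi> v i - \<psi> u i\<bar> \<le> lam * (R.a v - R.a u) + L * (v - u)"
      by (simp add: abs_le_iff split: if_splits)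
  qed (use assms(2) S.L_nonneg in auto)

  have small: "\<exists>N\<ge>K. N \<ge> 1 \<and> (\<forall>t\<in>{0..T}. \<forall>m. (\<Sum>j=Suc N..m. \<bar>z j t\<bar>) \<le> \<epsilon>)" if \<epsilon>: "\<epsilon> > 0" for \<epsilon>
  proof -
    obtain N0 where N0: "\<And>m n. m \<ge> N0 \<Longrightarrow> norm (\<Sum>k=m..<n. x (Suc k)) < \<epsilon>"
      using x_summable \<epsilon> unfolding summable_Cauchy by blast
    define N where "N = Max {N0, K, 1}"
    have N: "N0 \<le> N" "K \<le> N" "1 \<le> N" by (simp_all add: N_def)
    have "(\<Sum>j=Suc N..m. \<bar>z j t\<bar>) \<le> \<epsilon>" if t: "t \<in> {0..T}" for t m
    proof -
      have "(\<Sum>j=Suc N..m. \<bar>z j t\<bar>) = (\<Sum>j=Suc N..m. z j t)"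
        using z t by (intro sum.cong) auto
      also have "\<dots> \<le> (\<Sum>j=Suc N..m. x j)" by (rule tail[OF t N(2)])
      also have "\<dots> = (\<Sum>k=N..<m. x (Suc k))"
        by (simp add: sum.shift_bounds_Suc_ivl[symmetric] atLeastLessThanSuc_atLeastAtMost)
      also have "\<dots> \<le> \<epsilon>" using N0[OF N(1), of m] by simp
      finally show ?thesis .
    qed
    then show ?thesis using N by blast
  qed
  have zeta_ell1: "continuous_ell1 {0..T} \<zeta>"
  proof (rule continuous_ell1I)
    show "continuous_on {0..T} (\<lambda>t. \<zeta> t i)" if "i \<ge> 1" for i
      using zc[OF that] by (simp add: \<zeta>_def)
    show "\<exists>N. \<forall>t\<in>{0..T}. \<forall>m. (\<Sum>j=Suc N..m. \<bar>\<zeta> t j\<bar>) \<le> \<epsilon>" if "\<epsilon> > 0" for \<epsilon>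
      using small[OF that] by (auto simp: \<zeta>_def)
  qed
  have psi_ell1: "continuous_ell1 {0..T} \<psi>"
  proof (rule continuous_ell1I)
    show "continuous_on {0..T} (\<lambda>t. \<psi> t i)" if "i \<ge> 1" for i
      by (rule abs_continuous_on_imp_continuous_on[OF psi_ac[OF that]])
    show "\<exists>N. \<forall>t\<in>{0..T}. \<forall>m. (\<Sum>j=Suc N..m. \<bar>\<psi> t j\<bar>) \<le> \<epsilon>" if \<epsilon>: "\<epsilon> > 0" for \<epsilon>
    proof -
      obtain N where N: "N \<ge> K" "N \<ge> 1" "\<And>t m. t \<in> {0..T} \<Longrightarrow> (\<Sum>j=Suc N..m. \<bar>z j t\<bar>) \<le> \<epsilon>"
        using small[OF \<epsilon>] by blast
      \<comment> \<open>Beyond N both neighbouring regulators vanish, so the tails of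
        \<open>\<psi>\<close> are those of z and are uniformly small.\<close>
      have "\<psi> t j = z j t" if "j > N" "t \<in> {0..T}" for j t
        using \<zeta>_eq[of j t] eK[of j t] eK[of "j - 1" t] that N by (simp add: \<zeta>_def \<eta>_def)
      then have "(\<Sum>j=Suc N..m. \<bar>\<psi> t j\<bar>) = (\<Sum>j=Suc N..m. \<bar>z j t\<bar>)" if "t \<in> {0..T}" for m t
        using that by (intro sum.cong) auto
      then show ?thesis using N(3) by (intro exI[of _ N]) auto
    qed
  qed

  have paths: "(\<zeta>, \<psi>) \<in> paths_C T x"
  proof -
    have "\<zeta> t \<in> ell1_down" if "t \<in> {0..T}" for t
      using zeta_ell1 z that by (auto simp: ell1_down_def continuous_ell1_def \<zeta>_def)
    moreover have "\<zeta> 0 i = x i \<and> \<psi> 0 i = x i" if "i \<ge> 1" for i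
    proof -
      have psi0: "\<psi> 0 i = x i" by (simp add: \<psi>_def S.J_zero R.a_zero)
      have "e j 0 = 0" for j
        using e0[of 0] regulatesD(1)[OF e_reg, of j] assms(1) R.a_zero by (cases "j = 0") auto
      then show ?thesis using \<zeta>_eq[OF that, of 0] psi0 assms(1) by (simp add: \<eta>_def)
    qed
    moreover have "continuous_on {0..T} \<eta>"
    proof (rule continuous_on_coordinatewise_then_product)
      show "continuous_on {0..T} (\<lambda>t. \<eta> t i)" for i
        using regulatesD(2)[OF e_reg, of i] by (cases "i = 0") (simp_all add: \<eta>_def)
    qed
    moreover have "(LINT s:{0..T}|stieltjes T (\<lambda>t. \<eta> t i). 1 - \<zeta> s i) = 0" if i: "i \<ge> 1" for i
    proof -
      have "(LINT s:{0..T}|stieltjes T (e i). 1 - z i s) = 0"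
      proof (rule stieltjes_integral_0I)
        show "mono_on {0..T} (e i)" using e_reg[OF i] by (simp add: regulates_def)
        show "e i u = e i v" if "0 \<le> u" "u \<le> v" "v \<le> T" "\<And>s. u \<le> s \<Longrightarrow> s \<le> v \<Longrightarrow> z i s < 1" for u v
          by (rule D.reflected_flat[OF r _ i that]) (use z in auto)
      qed (use assms(1) zc[OF i] z[OF i] regulatesD(2)[OF e_reg[OF i]] in auto)
      then show ?thesis using i by (simp add: \<eta>_def \<zeta>_def)
    qed
    moreover have "\<eta> 0 i = 0 \<and> mono_on {0..T} (\<lambda>t. \<eta> t i)" if "i \<ge> 1" for i
      using e_reg[OF that] that by (simp add: regulates_def \<eta>_def)
    ultimately show ?thesis
      unfolding paths_C_def
      using zeta_ell1 psi_ell1 psi_ac z_ac \<zeta>_eq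
      by (auto simp: \<zeta>_def[abs_def] intro!: exI[of _ \<eta>]) (simp_all add: \<eta>_def)
  qed

  have J_diff: "(LINT (s, y):strip t|lborel. indicator {1 - \<zeta> s i..<1 - \<zeta> s (i + 1)} y * \<theta> (s, y))
      = S.J (z i) t - S.J (z (Suc i)) t" if "i \<ge> 1" "t \<in> {0..T}" for i t
    using S.J_diff(1)[OF zc zc that(2), of i "Suc i"] z[OF that(1)] z[of "Suc i"] that
    by (simp add: \<zeta>_def)
  have sol: "solves T lam x \<alpha> \<theta> \<zeta> \<psi>"
    unfolding solves_def using J_diff J_diff[of 1]
    by (simp add: \<psi>_def R.a_def numeral_2_eq_2)

  have unique: "\<zeta>' t i = \<zeta> t i \<and> \<psi>' t i = \<psi> t i"
    if p: "(\<zeta>', \<psi>') \<in> paths_C T x" and s: "solves T lam x \<alpha> \<theta> \<zeta>' \<psi>'" and t: "t \<in> {0..T}" and i: "i \<ge> 1"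
    for \<zeta>' \<psi>' t i
  proof -
    have down: "\<And>t. t \<in> {0..T} \<Longrightarrow> \<zeta>' t \<in> ell1_down"
      and ac: "\<And>i. i \<ge> 1 \<Longrightarrow> abs_continuous_on 0 T (\<lambda>t. \<zeta>' t i)"
      using p by (auto simp: paths_C_def)
    obtain \<eta>' where \<eta>': "continuous_on {0..T} \<eta>'" "\<forall>t\<in>{0..T}. \<eta>' t 0 = 0"
        "\<forall>t\<in>{0..T}. \<forall>i\<ge>1. \<zeta>' t i = \<psi>' t i + \<eta>' t (i - 1) - \<eta>' t i"
        "\<forall>i\<ge>1. \<eta>' 0 i = 0 \<and> mono_on {0..T} (\<lambda>t. \<eta>' t i) \<and>
           (LINT s:{0..T}|stieltjes T (\<lambda>t. \<eta>' t i). 1 - \<zeta>' s i) = 0"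
      using p by (auto simp: paths_C_def)
    have cont: "continuous_on {0..T} (\<lambda>t. \<zeta>' t i)" if "i \<ge> 1" for i
      by (rule abs_continuous_on_imp_continuous_on[OF ac[OF that]])
    have rng: "0 \<le> \<zeta>' t i \<and> \<zeta>' t i \<le> 1 \<and> \<zeta>' t (Suc i) \<le> \<zeta>' t i" if "i \<ge> 1" "t \<in> {0..T}" for i t
      using down[OF that(2)] that(1) by (auto simp: ell1_down_def)
    have psi': "\<psi>' t i = x i - S.J (\<lambda>s. \<zeta>' s i) t + S.J (\<lambda>s. \<zeta>' s (Suc i)) t + (if i = 1 then lam * R.a t else 0)"
      if "i \<ge> 1" "t \<in> {0..T}" for i t
      by (rule psi_eq[OF s that(2,1) cont]) (use rng in auto)
    have \<eta>'c: "continuous_on {0..T} (\<lambda>t. \<eta>' t i)" for i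
      by (rule continuous_on_product_then_coordinatewise[OF \<eta>'(1)])
    \<comment> \<open>The arrivals of the competitor are put back as the zeroth regulator, which
      turns its equations into those of the \<open>drift\<close> system.\<close>
    define e' where "e' i t = (if i = 0 then lam * R.a t else \<eta>' t i)" for i t
    have "D.reflected (\<lambda>i t. \<zeta>' t i) e'"
    proof (rule D.reflectedI)
      show "D.continuous_levels (\<lambda>i t. \<zeta>' t i)" using cont by (simp add: D.continuous_levels_def)
      show "\<zeta>' t i = D.level (\<lambda>i t. \<zeta>' t i) e' i t" if "i \<ge> 1" "t \<in> {0..T}" for i t
        using \<eta>'(2,3) psi'[OF that] that by (auto simp: D.level_def e'_def)
      show "e' i u = e' i v" if "i \<ge> 1" "0 \<le> u" "u \<le> v" "v \<le> T" "\<And>s. u \<le> s \<Longrightarrow> s \<le> v \<Longrightarrow> \<zeta>' s i < 1" for i u v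
      proof -
        have "\<eta>' u i = \<eta>' v i"
          by (rule stieltjes_integral_0D[where T = T and h = "\<lambda>s. \<zeta>' s i"])
            (use \<eta>'(4) \<eta>'c cont rng assms(1) that in auto)
        then show ?thesis using that(1) by (simp add: e'_def)
      qed
    qed (use rng \<eta>'(4) \<eta>'c in \<open>auto simp: e'_def[abs_def]\<close>)
    then have eq: "\<zeta>' t i = z i t" if "i \<ge> 1" "t \<in> {0..T}" for i t
      by (rule D.reflected_unique[OF _ r that])
    \<comment> \<open>The two paths agree only on [0, T]; the Lipschitz estimate with C = 0 shows
      that \<open>S.J\<close> does not see the difference.\<close>
    have "S.J (\<lambda>s. \<zeta>' s j) t = S.J (z j) t" if j: "j \<ge> 1" for j
      using D.J_diff_le[OF cont[OF j] zc[OF j], of 0 0 t] eq[OF j] t by simp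
    then show ?thesis using eq[OF i t] psi'[OF i t] i by (simp add: \<zeta>_def \<psi>_def)
  qed

  have shift_le: "0 \<le> z (Suc i) s \<and> z (Suc i) s \<le> z i s \<and> z i s \<le> 1" if "i \<ge> 1" "s \<in> {0..T}" for i s
    using z[OF that] z[of "Suc i" s] that by auto
  have shift: "shifted_control \<alpha> \<theta> \<zeta> i = (\<lambda>(s, y).
      \<theta> (s, y + 1 - z i s) * indicator {0..<z i s - z (Suc i) s} y + indicator {z i s - z (Suc i) s..<1} y)"
    if "i \<ge> 1" for i
    using that by (simp add: shifted_control_def \<zeta>_def)
  have shift_eq: "(LINT (s, y):strip t|lborel. indicator {0..<\<zeta> s i - \<zeta> s (i + 1)} y * shifted_control \<alpha> \<theta> \<zeta> i (s, y))
      = S.J (z i) t - S.J (z (Suc i)) t"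
    and shift_int: "set_integrable lborel (strip t)
      (\<lambda>(s, y). indicator {0..<\<zeta> s i - \<zeta> s (i + 1)} y * shifted_control \<alpha> \<theta> \<zeta> i (s, y))"
    if i: "i \<ge> 1" and t: "t \<in> {0..T}" for i t
    using S.shift_integral[OF zc zc t, of i "Suc i"] shift_le[OF i] i J_diff[OF i t]
    by (simp_all add: shift \<zeta>_def)
  have control: "shifted_control \<alpha> \<theta> \<zeta> \<in> controls_S T lam x \<zeta> \<psi>"
  proof -
    have "shifted_control \<alpha> \<theta> \<zeta> i \<in> nonneg_measurable T" for i
    proof (cases "i = 0")
      case True
      then show ?thesis using assms(4) by (simp add: shifted_control_def)
    next
      case False
      then show ?thesis
        using S.shift_measurable[OF zc zc, of i "Suc i"] shift_le[of i] by (simp add: shift)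
    qed
    moreover have "shifted_control \<alpha> \<theta> \<zeta> 0 = \<alpha>" by (simp add: shifted_control_def)
    moreover have "\<psi> t i = x i + (if i = 1 then lam * R.a t else 0)
        - (LINT (s, y):strip t|lborel. indicator {0..<\<zeta> s i - \<zeta> s (i + 1)} y * shifted_control \<alpha> \<theta> \<zeta> i (s, y))"
      if "i \<ge> 1" "t \<in> {0..T}" for i t
      using shift_eq[OF that] by (simp add: \<psi>_def)
    note this this[of 1]
    ultimately show ?thesis
      unfolding controls_S_def using R.alpha_integrable shift_int[of _ T] assms(1)
      by (simp add: R.a_def numeral_2_eq_2)
  qed
  show ?thesis
    using paths sol unique control by blast
qed

end
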